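(* Let $r,k$ be positive integers with $k\le (2r+1)/3$, and let $G$ be a $(2r+1)$-regular graph with exactly $2r+1-3(k-1)=2r+4-3k$ cut-edges. Then $G$ has no $2k$-factor if and only if $V(G)$ has a partition into sets $R,S,T$ (parts are allowed to be empty) such that all of the following hold: (a) $S$ and $T$ are independent sets (no edge, including loops, has both endpoints in $S$ or both endpoints in $T$), and $|T|>|S|$; (b) every cut-edge of $G$ joins a vertex of $T$ to a component of $G[R]$, distinct cut-edges go to distinct components of $G[R]$, and each component of $G[R]$ incident to such a cut-edge is joined to $S\cup T$ by no other edge; (c) all edges incident to $S$ lead to $T$, possibly via blisters that are components of $G[R]$; that is, every edge incident to a vertex of $S$ has its other endpoint either in $T$ or in a component of $G[R]$ that is a blister of an $S,T$-edge; (d) exactly $k(|T|-|S|)-1$ components of $G[R]$ are joined to $T$ by exactly three edges each; (e) each remaining component of $G[R]$ (one that is not incident to a cut-edge as in (b), not a blister as in (c), and not one of those counted in (d)) is itself $(2r+1)$-regular (hence is a component of $G$) and has no cut-edge; (f) if $k<(2r+1)/3$, then $|T|-|S|=1$.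
   Context: "Graph" means finite multigraph: loops and multiple edges are allowed, and a loop contributes $2$ to the degree of its vertex. Graphs need not be connected. An $\ell$-factor of a graph is an $\ell$-regular spanning subgraph. A cut-edge is an edge whose deletion increases the number of connected components. $G[R]$ is the subgraph of $G$ induced by $R$, and "component" means connected component. Blistering: in a $(2r+1)$-regular graph $G_0$, the result of blistering an edge $e\in E(G_0)$ by a $(2r+1)$-regular graph $H$ having no cut-edge is the graph obtained from the disjoint union $G_0+H$ by deleting $e$ and an edge $e'\in E(H)$ (where $e'$ may be a loop if $r>1$), and then adding two edges so that each endpoint of $e$ is made adjacent to one endpoint of $e'$ (the two new edges use different endpoints of $e$ and different endpoints of $e'$; if $e'$ is a loop, both new edges are attached to its vertex). Accordingly, a component $Q$ of $G[R]$ is a blister of an $S,T$-edge if exactly two edges of $G$ join $V(Q)$ to $S\cup T$, one of them having an endpoint in $S$ and the other an endpoint in $T$, and the graph $H$ obtained from $Q$ by adding an edge $e'$ joining the endpoints in $Q$ of these two edges (a loop if these endpoints coincide) is a $(2r+1)$-regular graph with no cut-edge. *)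

theory Defs
  imports Complex_Main "HOL-Library.Multiset"
begin

text \<open>
  Finite multigraphs with loops. Each edge carries the multiset of its two endpoints, so that
  \<open>ends G e = {#u, v#}\<close> for an edge joining \<open>u\<close> and \<open>v\<close>, and \<open>{#v, v#}\<close> for a loop at \<open>v\<close>.
  In \<open>vertex_degree\<close>, a loop therefore contributes 2.
\<close>

record ('v, 'e) mgraph =
  verts :: "'v set"
  edges :: "'e set"
  ends :: "'e \<Rightarrow> 'v multiset"

definition multigraph :: "('v, 'e) mgraph \<Rightarrow> bool" where
  "multigraph G \<longleftrightarrow> finite (verts G) \<and> finite (edges G) \<and>
     (\<forall>e\<in>edges G. size (ends G e) = 2 \<and> set_mset (ends G e) \<subseteq> verts G)"

definition vertex_degree :: "('v, 'e) mgraph \<Rightarrow> 'v \<Rightarrow> nat" where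
  "vertex_degree G v = (\<Sum>e\<in>edges G. count (ends G e) v)"

definition d_regular :: "nat \<Rightarrow> ('v, 'e) mgraph \<Rightarrow> bool" where
  "d_regular d G \<longleftrightarrow> (\<forall>v\<in>verts G. vertex_degree G v = d)"

definition spanning_subgraph :: "('v, 'e) mgraph \<Rightarrow> ('v, 'e) mgraph \<Rightarrow> bool" where
  "spanning_subgraph F G \<longleftrightarrow> verts F = verts G \<and> edges F \<subseteq> edges G \<and>
     (\<forall>e\<in>edges F. ends F e = ends G e)"

definition has_factor :: "nat \<Rightarrow> ('v, 'e) mgraph \<Rightarrow> bool" where
  "has_factor l G \<longleftrightarrow> (\<exists>F. spanning_subgraph F G \<and> d_regular l F)"

definition adjacency :: "('v, 'e) mgraph \<Rightarrow> ('v \<times> 'v) set" where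
  "adjacency G = {(u, v). \<exists>e\<in>edges G. ends G e = {#u, v#}}"

text \<open>Connected components are represented by their vertex sets; as a subgraph of \<open>G\<close>, the
  component \<open>C\<close> is \<open>induced_subgraph G C\<close>.\<close>

definition graph_components :: "('v, 'e) mgraph \<Rightarrow> 'v set set" where
  "graph_components G = {{w \<in> verts G. (v, w) \<in> (adjacency G)\<^sup>*} | v. v \<in> verts G}"

definition induced_subgraph :: "('v, 'e) mgraph \<Rightarrow> 'v set \<Rightarrow> ('v, 'e) mgraph" where
  "induced_subgraph G R = G\<lparr>verts := verts G \<inter> R, edges := {e \<in> edges G. set_mset (ends G e) \<subseteq> R}\<rparr>"

definition delete_edge :: "('v, 'e) mgraph \<Rightarrow> 'e \<Rightarrow> ('v, 'e) mgraph" where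
  "delete_edge G e = G\<lparr>edges := edges G - {e}\<rparr>"

definition add_edge :: "('v, 'e) mgraph \<Rightarrow> 'e \<Rightarrow> 'v \<Rightarrow> 'v \<Rightarrow> ('v, 'e) mgraph" where
  "add_edge G e u v = G\<lparr>edges := insert e (edges G), ends := (ends G)(e := {#u, v#})\<rparr>"

definition cut_edges :: "('v, 'e) mgraph \<Rightarrow> 'e set" where
  "cut_edges G = {e \<in> edges G. card (graph_components G) < card (graph_components (delete_edge G e))}"

definition independent_set :: "('v, 'e) mgraph \<Rightarrow> 'v set \<Rightarrow> bool" where
  "independent_set G A \<longleftrightarrow> (\<forall>e\<in>edges G. \<not> set_mset (ends G e) \<subseteq> A)"

definition edges_between :: "('v, 'e) mgraph \<Rightarrow> 'v set \<Rightarrow> 'v set \<Rightarrow> 'e set" where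
  "edges_between G A B = {e \<in> edges G. \<exists>a\<in>A. \<exists>b\<in>B. ends G e = {#a, b#}}"

text \<open>
  \<open>blister d G S T Q\<close>: the component with vertex set \<open>Q\<close> of the graph induced on the complement
  of \<open>S \<union> T\<close> is a blister, in the \<open>d\<close>-regular graph \<open>G\<close>, of an edge joining \<open>s \<in> S\<close> and \<open>t \<in> T\<close>.
  The edge \<open>f\<close>, which is not an edge of \<open>induced_subgraph G Q\<close>, only serves as a fresh name for the edge
  added to it; that edge is a loop if \<open>p = q\<close>.
\<close>

definition blister :: "nat \<Rightarrow> ('v, 'e) mgraph \<Rightarrow> 'v set \<Rightarrow> 'v set \<Rightarrow> 'v set \<Rightarrow> bool" where
  "blister d G S T Q \<longleftrightarrow> (\<exists>f g. \<exists>s\<in>S. \<exists>t\<in>T. \<exists>p\<in>Q. \<exists>q\<in>Q.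
     f \<noteq> g \<and> edges_between G Q (S \<union> T) = {f, g} \<and>
     ends G f = {#s, p#} \<and> ends G g = {#t, q#} \<and>
     d_regular d (add_edge (induced_subgraph G Q) f p q) \<and>
     cut_edges (add_edge (induced_subgraph G Q) f p q) = {})"

end

theory Submission
  imports Defs
begin

text \<open>
  The theorem is a sharp count on top of the Tutte--Belck criterion for regular factors: a
  multigraph has no \<open>l\<close>-factor iff there are disjoint sets \<open>S\<close> and \<open>T\<close> such that, with \<open>R\<close> the set
  of remaining vertices and \<open>q\<close> the number of components \<open>Q\<close> of \<open>G[R]\<close> for which
  \<open>l |Q| + e(T, Q)\<close> is odd,
  \<open>l |T| + e(S, T) + q > l |S| + (\<Sum>v\<in>T. deg v)\<close>.

  \<^bold>\<open>The count.\<close> Let \<open>l = 2 k\<close>, let \<open>G\<close> be \<open>(2 r + 1)\<close>-regular, put \<open>D = |T| - |S|\<close>, and let \<open>x\<close> and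
  \<open>y\<close> be the numbers of edges from a component \<open>Q\<close> to \<open>T\<close> and to \<open>S\<close>. The degree sums of \<open>S\<close> and \<open>T\<close>
  turn the inequality into a lower bound on a sum over the components, in which \<open>Q\<close> has the weight
  \<open>3 [x odd] - x - 2 y\<close>. This weight is at most \<open>0\<close>, except that it is \<open>2\<close> when \<open>x = 1\<close> and
  \<open>y = 0\<close>; in that case the only edge leaving \<open>Q\<close> is a cut-edge. So the number of cut-edges bounds
  the sum from above, and with exactly \<open>2 r + 4 - 3 k\<close> cut-edges the two bounds coincide. All
  estimates are then equalities: every cut-edge is the only edge leaving some component, every
  component has \<open>(x, y)\<close> equal to \<open>(0, 0)\<close>, \<open>(1, 0)\<close>, \<open>(1, 1)\<close> or \<open>(3, 0)\<close>, no edge lies inside \<open>S\<close>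
  or inside \<open>T\<close>, there are \<open>k D - 1\<close> components of type \<open>(3, 0)\<close>, and \<open>D = 1\<close> unless
  \<open>3 k = 2 r + 1\<close>; this is \<open>tight_structure\<close>. Components of type \<open>(1, 1)\<close> are blisters, and components of
  type \<open>(0, 0)\<close> have no cut-edge, because a cut-edge in either of these graphs would yield a
  cut-edge of \<open>G\<close> that does not meet \<open>T\<close>. Conversely, every such partition satisfies the
  inequality of the criterion (\<open>no_factor_if_tight\<close>).

  \<^bold>\<open>The criterion.\<close> Necessity is a parity count (\<open>regular_factor_inequality\<close>). For sufficiency
  (\<open>no_factor_witness\<close>) the \<open>l\<close>-factors of \<open>G\<close> are turned into the perfect matchings of an auxiliary
  graph that has \<open>l\<close> copies of each vertex and one vertex for each half-edge. A form of the
  Tutte--Berge theorem (\<open>tutte_berge_labelling\<close>), proved by Gallai's argument, yields an obstruction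
  to a perfect matching. In an obstruction of minimum size each vertex of \<open>G\<close> contributes all its
  copies, all its half-edges, or nothing; these three cases define \<open>S\<close>, \<open>T\<close> and \<open>R\<close>.
\<close>

section \<open>Matchings and barriers\<close>

lemma Union_Diff_disjnt:
  assumes "pairwise disjnt M" "m \<in> M"
  shows "\<Union>(M - {m}) = \<Union>M - m"
  using assms unfolding pairwise_def disjnt_def by blast

lemma pairwise_disjnt_insert:
  assumes "pairwise disjnt M" "m \<inter> \<Union>M = {}"
  shows "pairwise disjnt (insert m M)"
  using assms unfolding pairwise_insert disjnt_def by blast

lemma card_Union_matching:
  assumes "finite M" "pairwise disjnt M" "\<forall>m\<in>M. card m = 2"
  shows "card (\<Union>M) = 2 * card M"
proof -
  have "card (\<Union>M) = sum card M"
    using assms by (intro card_Union_disjoint) (auto intro: card_ge_0_finite)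
  thus ?thesis using assms(3) by simp
qed

text \<open>
  Symmetric differences without paths: follow the alternating path of \<open>M\<close> and \<open>N\<close> that starts at
  \<open>v\<close>. If it ends at a vertex missed by \<open>N\<close>, it augments \<open>N\<close>; if it ends at a vertex \<open>z\<close> missed by
  \<open>M\<close>, swapping along it turns \<open>M\<close> into a matching of the same size that covers \<open>z\<close> instead of
  \<open>v\<close>. The induction removes the first two edges of the path. That the result uses only edges of
  \<open>M \<union> N\<close> lets the two removed edges be put back.
\<close>
lemma matching_exchange:
  fixes M N :: "'a set set"
  assumes "finite M" "finite N" "pairwise disjnt M" "pairwise disjnt N"
    and "\<forall>m\<in>M \<union> N. card m = 2" and "v \<in> \<Union>M" and "v \<notin> \<Union>N"
  shows "(\<exists>N'. N' \<subseteq> M \<union> N \<and> pairwise disjnt N' \<and> card N' = Suc (card N)) \<or>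
    (\<exists>M' z. M' \<subseteq> M \<union> N \<and> pairwise disjnt M' \<and> card M' = card M \<and>
       z \<notin> \<Union>M \<and> \<Union>M' = insert z (\<Union>M - {v}))"
  using assms
proof (induction "card M" arbitrary: M N v rule: less_induct)
  case less
  note fin = less.prems(1,2) and dM = less.prems(3) and dN = less.prems(4)
    and two = less.prems(5) and vM = less.prems(6) and vN = less.prems(7)
  obtain m where m: "m \<in> M" "v \<in> m" using vM by blast
  with two obtain x where mx: "m = {v, x}" "x \<noteq> v"
    by (metis UnI1 card_2_iff insert_iff doubleton_eq_iff singletonD)
  define M2 where "M2 = M - {m}"
  have UM2: "\<Union>M2 = \<Union>M - {v, x}"
    using Union_Diff_disjnt[OF dM m(1)] mx(1) unfolding M2_def by simp
  have xM: "x \<in> \<Union>M" using m(1) mx(1) by blast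
  have cM: "card M = Suc (card M2)" unfolding M2_def using fin(1) m(1) by (metis card_Suc_Diff1)
  have dM2: "pairwise disjnt M2" unfolding M2_def using dM by (auto intro: pairwise_subset)
  show ?case
  proof (cases "x \<in> \<Union>N")
    case False
    have "m \<notin> N" using vN m(2) by blast
    hence "card (insert m N) = Suc (card N)" using fin(2) by simp
    moreover have "pairwise disjnt (insert m N)"
      using dN False vN mx by (intro pairwise_disjnt_insert) auto
    ultimately show ?thesis using m(1) by (intro disjI1 exI[of _ "insert m N"]) auto
  next
    case True
    then obtain n where n: "n \<in> N" "x \<in> n" by blast
    with two obtain y where ny: "n = {x, y}" "y \<noteq> x"
      by (metis UnI2 card_2_iff insert_iff doubleton_eq_iff singletonD)
    have yv: "y \<noteq> v" using vN n ny by blast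
    define N2 where "N2 = N - {n}"
    have UN2: "\<Union>N2 = \<Union>N - {x, y}"
      using Union_Diff_disjnt[OF dN n(1)] ny(1) unfolding N2_def by simp
    have cN: "card N = Suc (card N2)" unfolding N2_def using fin(2) n(1) by (metis card_Suc_Diff1)
    have dN2: "pairwise disjnt N2" unfolding N2_def using dN by (auto intro: pairwise_subset)
    have avoid: "v \<notin> \<Union>(M2 \<union> N2)" "x \<notin> \<Union>(M2 \<union> N2)" using UM2 UN2 vN by auto
    have fin2: "finite M2" "finite N2" unfolding M2_def N2_def using fin by auto
    \<comment> \<open>The path begins \<open>v, x, y\<close>. If \<open>M\<close> covers \<open>y\<close>, it continues from \<open>y\<close> in \<open>M2\<close> and \<open>N2\<close>, neither
      of which covers \<open>v\<close> or \<open>x\<close>.\<close>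
    show ?thesis
    proof (cases "y \<in> \<Union>M")
      case False
      have "n \<notin> M2" using False ny unfolding M2_def by blast
      hence "card (insert n M2) = card M" using fin2(1) cM by simp
      moreover have "pairwise disjnt (insert n M2)"
        using dM2 False UM2 ny by (intro pairwise_disjnt_insert) auto
      moreover have "\<Union>(insert n M2) = insert y (\<Union>M - {v})"
        using UM2 ny yv mx xM by auto
      moreover have "insert n M2 \<subseteq> M \<union> N" using n(1) unfolding M2_def by auto
      ultimately show ?thesis using False by blast
    next
      case True
      have "(\<exists>N'. N' \<subseteq> M2 \<union> N2 \<and> pairwise disjnt N' \<and> card N' = Suc (card N2)) \<or>
        (\<exists>M' z. M' \<subseteq> M2 \<union> N2 \<and> pairwise disjnt M' \<and> card M' = card M2 \<and>
           z \<notin> \<Union>M2 \<and> \<Union>M' = insert z (\<Union>M2 - {y}))"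
      proof (rule less.hyps)
        show "card M2 < card M" using cM by simp
        show "y \<in> \<Union>M2" using True UM2 yv ny by simp
        show "y \<notin> \<Union>N2" using UN2 by simp
        show "\<forall>m\<in>M2 \<union> N2. card m = 2" using two unfolding M2_def N2_def by blast
      qed (use fin2 dM2 dN2 in auto)
      thus ?thesis
      proof (elim disjE exE conjE)
        fix N' assume N': "N' \<subseteq> M2 \<union> N2" "pairwise disjnt N'" "card N' = Suc (card N2)"
        have av: "v \<notin> \<Union>N'" "x \<notin> \<Union>N'" using avoid N'(1) by blast+
        have "m \<notin> N'" using av(1) m(2) by blast
        moreover have "finite N'" using N'(3) card_ge_0_finite by force
        ultimately have "card (insert m N') = Suc (card N)" using N'(3) cN by simp
        moreover have "pairwise disjnt (insert m N')"
          using N'(2) av mx by (intro pairwise_disjnt_insert) auto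
        moreover have "insert m N' \<subseteq> M \<union> N" using N'(1) m(1) unfolding M2_def N2_def by auto
        ultimately show ?thesis by blast
      next
        fix M' z assume M': "M' \<subseteq> M2 \<union> N2" "pairwise disjnt M'" "card M' = card M2"
          "z \<notin> \<Union>M2" "\<Union>M' = insert z (\<Union>M2 - {y})"
        have zM': "z \<in> \<Union>M'" using M'(5) by blast
        have zy: "z \<noteq> y" using M'(4) True UM2 yv ny by auto
        have zvx: "z \<noteq> v" "z \<noteq> x" using zM' M'(1) avoid by blast+
        have av: "y \<notin> \<Union>M'" "x \<notin> \<Union>M'" using M'(5) zy zvx UM2 by auto
        have "n \<notin> M'" using av(2) n(2) by blast
        moreover have "finite M'" using M'(1) fin2 finite_subset by blast
        ultimately have "card (insert n M') = card M" using M'(3) cM by simp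
        moreover have "pairwise disjnt (insert n M')"
          using M'(2) av ny by (intro pairwise_disjnt_insert) auto
        moreover have "insert n M' \<subseteq> M \<union> N" using M'(1) n(1) unfolding M2_def N2_def by auto
        moreover have "z \<notin> \<Union>M" using M'(4) UM2 zvx by auto
        moreover have "\<Union>(insert n M') = insert z (\<Union>M - {v})"
          using M'(5) UM2 ny yv True xM mx(2) by auto
        ultimately show ?thesis by blast
      qed
    qed
  qed
qed

text \<open>
  A labelling \<open>c\<close> that is constant along edges avoiding \<open>U\<close> has unions of components as its classes.
  Counting odd label classes instead of odd components gives a weaker notion of obstruction that is
  as good for the duality and is easily relabelled.
\<close>
definition odd_classes :: "'a set \<Rightarrow> ('a \<Rightarrow> 'b) \<Rightarrow> 'b set" where
  "odd_classes W c = {i. odd (card {x \<in> W. c x = i})}"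

lemma odd_classes_subset_image: "odd_classes W c \<subseteq> c ` W"
proof
  fix i assume "i \<in> odd_classes W c"
  hence "{x \<in> W. c x = i} \<noteq> {}" unfolding odd_classes_def by (metis (mono_tags, lifting) mem_Collect_eq card.empty even_zero)
  thus "i \<in> c ` W" by blast
qed

lemma finite_odd_classes: "finite W \<Longrightarrow> finite (odd_classes W c)"
  using odd_classes_subset_image finite_surj by metis

text \<open>
  The hard half of the Tutte--Berge formula. If some vertex is covered by every maximum matching,
  it goes into \<open>U\<close> and is deleted, which lowers the matching number by one. Otherwise Gallai's
  argument applies with \<open>U = {}\<close>: call two vertices equivalent if no maximum matching misses both of
  them. Adjacent vertices are equivalent, and the exchange lemma makes the relation transitive. The
  equivalence classes are the labels. A maximum matching stays inside the classes and misses at most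
  one vertex of each, so that the classes with a missed vertex are odd.
\<close>
theorem tutte_berge_labelling:
  fixes V :: "'a set" and E :: "'a set set"
  assumes "finite V" and "\<forall>m\<in>E. m \<subseteq> V \<and> card m = 2"
  shows "\<exists>M U. \<exists>c :: 'a \<Rightarrow> 'a set. M \<subseteq> E \<and> pairwise disjnt M \<and> U \<subseteq> V \<and>
    (\<forall>x y. {x, y} \<in> E \<longrightarrow> x \<notin> U \<longrightarrow> y \<notin> U \<longrightarrow> c x = c y) \<and>
    card V + card U \<le> 2 * card M + card (odd_classes (V - U) c)"
  using assms
proof (induction "card V" arbitrary: V E rule: less_induct)
  case less
  note finV = less.prems(1) and E = less.prems(2)
  have finE: "finite E" using E finV by (meson Pow_iff finite_Pow_iff finite_subset subsetI)
  define is_matching where "is_matching M \<longleftrightarrow> M \<subseteq> E \<and> pairwise disjnt M" for M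
  have "\<exists>M. is_matching M \<and> (\<forall>N. is_matching N \<longrightarrow> card N \<le> card M)"
  proof -
    have "is_matching {}" unfolding is_matching_def by simp
    moreover have "\<forall>N. is_matching N \<longrightarrow> card N < Suc (card E)"
      unfolding is_matching_def using finE by (simp add: card_mono less_Suc_eq_le)
    ultimately show ?thesis using ex_has_greatest_nat[of is_matching "{}" card "Suc (card E)"] by simp
  qed
  then obtain M0 where M0: "is_matching M0" "\<And>N. is_matching N \<Longrightarrow> card N \<le> card M0" by blast
  define maxi where "maxi M \<longleftrightarrow> is_matching M \<and> card M = card M0" for M
  have cov: "card (\<Union>M) = 2 * card M" "finite M" "\<Union>M \<subseteq> V" if "is_matching M" for M
    using that E finE finite_subset[of M E] unfolding is_matching_def
    by (auto intro!: card_Union_matching)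
  show ?case
  proof (cases "\<exists>v\<in>V. \<forall>M. maxi M \<longrightarrow> v \<in> \<Union>M")
    case True
    then obtain v where v: "v \<in> V" "\<And>M. maxi M \<Longrightarrow> v \<in> \<Union>M" by blast
    let ?E = "{m \<in> E. v \<notin> m}" and ?V = "V - {v}"
    have lt: "card ?V < card V" using finV v(1) by (meson card_Diff1_less)
    have pE: "\<forall>m\<in>?E. m \<subseteq> ?V \<and> card m = 2" using E by blast
    have "\<exists>M U. \<exists>c :: 'a \<Rightarrow> 'a set. M \<subseteq> ?E \<and> pairwise disjnt M \<and> U \<subseteq> ?V \<and>
      (\<forall>x y. {x, y} \<in> ?E \<longrightarrow> x \<notin> U \<longrightarrow> y \<notin> U \<longrightarrow> c x = c y) \<and>
      card ?V + card U \<le> 2 * card M + card (odd_classes (?V - U) c)"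
      by (rule less.hyps[OF lt _ pE]) (use finV in simp)
    then obtain M U and c :: "'a \<Rightarrow> 'a set" where IH: "M \<subseteq> ?E" "pairwise disjnt M" "U \<subseteq> ?V"
      "\<forall>x y. {x, y} \<in> ?E \<longrightarrow> x \<notin> U \<longrightarrow> y \<notin> U \<longrightarrow> c x = c y"
      "card ?V + card U \<le> 2 * card M + card (odd_classes (?V - U) c)"
      by blast
    have mM: "is_matching M" using IH(1,2) unfolding is_matching_def by blast
    have "v \<notin> \<Union>M" using IH(1) by blast
    hence "card M \<noteq> card M0" using v(2) mM unfolding maxi_def by blast
    hence lt: "card M < card M0" using M0(2)[OF mM] by simp
    have cU: "card (insert v U) = Suc (card U)"
      using IH(3) finV by (metis Diff_iff card_insert_disjoint finite_Diff finite_subset insertI1 subsetD)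
    have cV: "card V = Suc (card ?V)" using finV v(1) by (metis card_Suc_Diff1)
    have "V - insert v U = ?V - U" by blast
    hence "card V + card (insert v U) \<le> 2 * card M0 + card (odd_classes (V - insert v U) c)"
      using IH(5) cU cV lt by simp
    moreover have "\<forall>x y. {x, y} \<in> E \<longrightarrow> x \<notin> insert v U \<longrightarrow> y \<notin> insert v U \<longrightarrow> c x = c y"
      using IH(4) by blast
    moreover have "insert v U \<subseteq> V" using IH(3) v(1) by blast
    ultimately show ?thesis using M0(1) unfolding is_matching_def by blast
  next
    case False
    hence missed: "\<exists>M. maxi M \<and> v \<notin> \<Union>M" if "v \<in> V" for v using that by blast
    define eqv where "eqv x y \<longleftrightarrow> x = y \<or> (\<forall>M. maxi M \<longrightarrow> x \<in> \<Union>M \<or> y \<in> \<Union>M)" for x y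
    have eqv_sym: "eqv x y \<Longrightarrow> eqv y x" for x y unfolding eqv_def by blast
    have eqv_trans: "eqv u w" if uv: "eqv u v" and vw: "eqv v w" and vV: "v \<in> V" for u v w
    proof (rule ccontr)
      assume "\<not> eqv u w"
      then obtain M where M: "maxi M" "u \<notin> \<Union>M" "w \<notin> \<Union>M" and "u \<noteq> w"
        unfolding eqv_def by blast
      have "u \<noteq> v" "v \<noteq> w" using \<open>\<not> eqv u w\<close> uv vw by auto
      obtain N where N: "maxi N" "v \<notin> \<Union>N" using missed[OF vV] by blast
      have vM: "v \<in> \<Union>M" using uv \<open>u \<noteq> v\<close> M(1,2) unfolding eqv_def by blast
      have mM: "M \<subseteq> E" "pairwise disjnt M" "finite M" and mN: "N \<subseteq> E" "pairwise disjnt N" "finite N"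
        and cards: "card M = card M0" "card N = card M0"
        using M(1) N(1) cov(2) unfolding maxi_def is_matching_def by auto
      have two: "\<forall>m\<in>M \<union> N. card m = 2" using mM(1) mN(1) E by blast
      from matching_exchange[OF mM(3) mN(3) mM(2) mN(2) two vM N(2)] show False
      \<comment> \<open>An augmentation contradicts maximality. A shift of \<open>M\<close> to a matching missing \<open>v\<close> covers only
        one new vertex, so it still misses \<open>u\<close> or \<open>w\<close>, against \<open>eqv u v\<close> or \<open>eqv v w\<close>.\<close>
      proof (elim disjE exE conjE)
        fix N' assume N': "N' \<subseteq> M \<union> N" "pairwise disjnt N'" "card N' = Suc (card N)"
        have "is_matching N'" unfolding is_matching_def using N' mM(1) mN(1) by blast
        thus False using M0(2) N'(3) cards by fastforce
      next
        fix M' z assume M': "M' \<subseteq> M \<union> N" "pairwise disjnt M'" "card M' = card M"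
          "z \<notin> \<Union>M" "\<Union>M' = insert z (\<Union>M - {v})"
        have "maxi M'" unfolding maxi_def is_matching_def using M' mM(1) mN(1) cards by auto
        moreover have "v \<notin> \<Union>M'" using M'(4) vM unfolding M'(5) by auto
        ultimately have "u \<in> \<Union>M'" "w \<in> \<Union>M'"
          using uv vw \<open>u \<noteq> v\<close> \<open>v \<noteq> w\<close> unfolding eqv_def by blast+
        thus False using M(2,3) \<open>u \<noteq> w\<close> unfolding M'(5) by auto
      qed
    qed
    have eqv_edge: "eqv x y" if xy: "{x, y} \<in> E" for x y
      unfolding eqv_def
    proof (rule disjI2, rule allI, rule impI, rule ccontr)
      fix M assume M: "maxi M" and nc: "\<not> (x \<in> \<Union>M \<or> y \<in> \<Union>M)"
      have "is_matching (insert {x, y} M)"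
        using M xy nc unfolding maxi_def is_matching_def
        by (auto intro!: pairwise_disjnt_insert)
      moreover have "card (insert {x, y} M) = Suc (card M)"
        using nc M cov(2) unfolding maxi_def by (intro card_insert_disjoint) auto
      ultimately show False using M0(2) M unfolding maxi_def by fastforce
    qed
    define c where "c x = {y \<in> V. eqv x y}" for x
    have c_eq: "c x = c y" if "eqv x y" "x \<in> V" "y \<in> V" for x y
      using that eqv_trans eqv_sym unfolding c_def by blast
    have c_eqD: "eqv x y" if "c x = c y" "y \<in> V" for x y
    proof -
      have "y \<in> c y" unfolding c_def eqv_def using that(2) by simp
      thus ?thesis using that(1) unfolding c_def by blast
    qed
    have maxi0: "maxi M0" unfolding maxi_def using M0(1) by simp
    have "c ` (V - \<Union>M0) \<subseteq> odd_classes (V - {}) c"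
    proof (intro image_subsetI)
      fix x assume x: "x \<in> V - \<Union>M0"
      let ?P = "{y \<in> V. c y = c x}"
      let ?N = "{m \<in> M0. m \<subseteq> ?P}"
      have "?P - {x} = \<Union>?N"
      proof (intro equalityI subsetI)
        fix y assume y: "y \<in> ?P - {x}"
        hence "eqv x y" using c_eqD[of x y] by simp
        hence "y \<in> \<Union>M0" using y x maxi0 unfolding eqv_def by blast
        then obtain m where m: "m \<in> M0" "y \<in> m" by blast
        hence mE: "m \<in> E" using M0(1) unfolding is_matching_def by blast
        with E have mc: "card m = 2" "m \<subseteq> V" by auto
        then obtain w where w: "m = {y, w}" using m(2) by (metis card_2_iff insert_iff doubleton_eq_iff singletonD)
        have "c w = c y" using c_eq[of y w] eqv_edge[of y w] w mE mc(2) by auto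
        hence "m \<subseteq> ?P" using w mc(2) y by auto
        thus "y \<in> \<Union>?N" using m by blast
      next
        fix y assume "y \<in> \<Union>?N" thus "y \<in> ?P - {x}" using x by blast
      qed
      moreover have "card (\<Union>?N) = 2 * card ?N"
        using M0(1) E cov(2)[OF M0(1)] unfolding is_matching_def
        by (intro card_Union_matching) (auto intro: pairwise_subset)
      moreover have "card ?P = Suc (card (?P - {x}))"
        using x finV by (intro card.remove) auto
      ultimately have "card ?P = Suc (2 * card ?N)" by simp
      thus "c x \<in> odd_classes (V - {}) c" unfolding odd_classes_def by simp
    qed
    moreover have "inj_on c (V - \<Union>M0)"
    proof (rule inj_onI)
      fix x y assume "x \<in> V - \<Union>M0" "y \<in> V - \<Union>M0" "c x = c y"
      thus "x = y" using c_eqD[of x y] maxi0 unfolding eqv_def by blast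
    qed
    ultimately have "card (V - \<Union>M0) \<le> card (odd_classes (V - {}) c)"
      using finV by (intro card_inj_on_le[of c]) (auto intro: finite_odd_classes)
    moreover have "card (V - \<Union>M0) = card V - 2 * card M0" 
      using cov[OF M0(1)] finV by (metis card_Diff_subset finite_subset)
    ultimately have "card V + card {} \<le> 2 * card M0 + card (odd_classes (V - {}) c)" by simp
    moreover have "\<forall>x y. {x, y} \<in> E \<longrightarrow> x \<notin> {} \<longrightarrow> y \<notin> {} \<longrightarrow> c x = c y"
      using eqv_edge c_eq E by blast
    ultimately show ?thesis using M0(1) unfolding is_matching_def by blast
  qed
qed

text \<open>
  An odd class of a coarser labelling is a disjoint union of classes of a finer one, one of which
  must be odd.
\<close>
lemma card_odd_classes_le_refinement:
  assumes fin: "finite W" and fac: "\<And>x. x \<in> W \<Longrightarrow> c x = g (\<pi> x)"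
  shows "card (odd_classes W c) \<le> card (odd_classes W \<pi>)"
proof (rule surj_card_le)
  show "finite (odd_classes W \<pi>)" using fin by (rule finite_odd_classes)
  show "odd_classes W c \<subseteq> g ` odd_classes W \<pi>"
  proof
    fix i assume "i \<in> odd_classes W c"
    hence i: "odd (card {x \<in> W. c x = i})" unfolding odd_classes_def by simp
    let ?J = "{j \<in> \<pi> ` W. g j = i}"
    have "{x \<in> W. c x = i} = (\<Union>j\<in>?J. {x \<in> W. \<pi> x = j})" using fac by auto
    hence "card {x \<in> W. c x = i} = (\<Sum>j\<in>?J. card {x \<in> W. \<pi> x = j})"
      using fin by (simp only:) (rule card_UN_disjoint, auto)
    with i have "odd (\<Sum>j\<in>?J. card {x \<in> W. \<pi> x = j})" by metis
    then obtain j where "j \<in> ?J" "odd (card {x \<in> W. \<pi> x = j})"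
      using dvd_sum[of ?J 2 "\<lambda>j. card {x \<in> W. \<pi> x = j}"] by blast
    thus "i \<in> g ` odd_classes W \<pi>" unfolding odd_classes_def by blast
  qed
qed

text \<open>
  A Tutte set \<open>U\<close> with a labelling that certifies it: in a perfect matching each odd class would have
  a vertex matched to a different element of \<open>U\<close>.
\<close>
definition barrier :: "'a set \<Rightarrow> 'a set set \<Rightarrow> 'a set \<Rightarrow> ('a \<Rightarrow> 'b) \<Rightarrow> bool" where
  "barrier V E U c \<longleftrightarrow> U \<subseteq> V \<and>
     (\<forall>x y. {x, y} \<in> E \<longrightarrow> x \<notin> U \<longrightarrow> y \<notin> U \<longrightarrow> c x = c y) \<and>
     card U < card (odd_classes (V - U) c)"

text \<open>
  If the neighbours of \<open>x \<in> U\<close> outside \<open>U\<close> carried at most the two labels \<open>i\<close> and \<open>j\<close>, then moving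
  \<open>x\<close> out of \<open>U\<close> and merging both classes with \<open>x\<close> would lose at most one odd class (two odd classes
  and \<open>x\<close> make an odd one), leaving a smaller barrier.
\<close>
lemma minimal_barrier_neighbour:
  fixes c :: "'a \<Rightarrow> 'b"
  assumes finV: "finite V" and E: "\<forall>m\<in>E. m \<subseteq> V \<and> card m = 2"
    and bar: "barrier V E U c"
    and minimal: "\<And>U' (c' :: 'a \<Rightarrow> 'b). barrier V E U' c' \<Longrightarrow> card U \<le> card U'"
    and x: "x \<in> U"
  shows "\<exists>y\<in>V - U. {x, y} \<in> E \<and> c y \<noteq> i \<and> c y \<noteq> j"
proof (rule ccontr)
  assume "\<not> ?thesis"
  hence none: "c y = i \<or> c y = j" if "y \<in> V" "y \<notin> U" "{x, y} \<in> E" for y using that by blast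
  have U: "U \<subseteq> V" "finite U" using bar finV finite_subset unfolding barrier_def by blast+
  define U' where "U' = U - {x}"
  define c' where "c' y = (if y = x \<or> c y = i \<or> c y = j then i else c y)" for y
  let ?W = "V - U"
  have W': "V - U' = insert x ?W" unfolding U'_def using x U by blast
  have respect: "c' a = c' b" if ab: "{a, b} \<in> E" "a \<notin> U'" "b \<notin> U'" for a b
  proof -
    have "a \<noteq> b" "a \<in> V" "b \<in> V" using E ab(1) by fastforce+
    show ?thesis
    proof (cases "a = x \<or> b = x")
      case True
      thus ?thesis
        using none[of a] none[of b] ab \<open>a \<noteq> b\<close> \<open>a \<in> V\<close> \<open>b \<in> V\<close>
        unfolding U'_def c'_def by (auto simp: insert_commute)
    next
      case False
      hence "c a = c b" using bar ab unfolding barrier_def U'_def by blast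
      thus ?thesis using False unfolding c'_def by simp
    qed
  qed
  have same: "h \<in> odd_classes (V - U') c'" if "h \<in> odd_classes ?W c" "h \<noteq> i" "h \<noteq> j" for h
  proof -
    have "{y \<in> V - U'. c' y = h} = {y \<in> ?W. c y = h}"
      unfolding W' c'_def using that x by auto
    thus ?thesis using that(1) unfolding odd_classes_def by simp
  qed
  have "\<exists>h. odd_classes ?W c - {h} \<subseteq> odd_classes (V - U') c'"
  proof (cases "i \<in> odd_classes ?W c \<and> j \<in> odd_classes ?W c \<and> i \<noteq> j")
    case False
    thus ?thesis using same by blast
  next
    case True
    have "{y \<in> V - U'. c' y = i} = insert x ({y \<in> ?W. c y = i} \<union> {y \<in> ?W. c y = j})"
      unfolding W' c'_def by auto
    moreover have "card \<dots> = Suc (card {y \<in> ?W. c y = i} + card {y \<in> ?W. c y = j})"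
      using finV x True by (subst card_insert_disjoint) (auto intro: card_Un_disjoint)
    ultimately have "i \<in> odd_classes (V - U') c'"
      using True unfolding odd_classes_def by simp
    thus ?thesis using same by (intro exI[of _ j]) blast
  qed
  then obtain h where h: "odd_classes ?W c - {h} \<subseteq> odd_classes (V - U') c'" by blast
  have "finite (odd_classes (V - U') c')" using finV by (intro finite_odd_classes) simp
  with h have "card (odd_classes ?W c - {h}) \<le> card (odd_classes (V - U') c')" by (rule card_mono[rotated])
  moreover have "card (odd_classes ?W c) - 1 \<le> card (odd_classes ?W c - {h})"
    using diff_card_le_card_Diff[of "{h}" "odd_classes ?W c"] by simp
  moreover have "card U' < card U" unfolding U'_def using x U by (meson card_Diff1_less)
  moreover have "card U < card (odd_classes ?W c)" using bar unfolding barrier_def by blast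
  ultimately have "card U' < card (odd_classes (V - U') c')" by linarith
  hence "barrier V E U' c'" unfolding barrier_def using respect U unfolding U'_def by blast
  thus False using minimal \<open>card U' < card U\<close> by fastforce
qed

section \<open>Connected components\<close>

lemma multigraph_endsD:
  assumes "multigraph G" "e \<in> edges G"
  obtains a b where "ends G e = {#a, b#}" "a \<in> verts G" "b \<in> verts G"
proof -
  have "size (ends G e) = 2" "set_mset (ends G e) \<subseteq> verts G"
    using assms unfolding multigraph_def by auto
  moreover from this(1) obtain a b where "ends G e = {#a, b#}"
    by (metis (no_types, lifting) numeral_2_eq_2 size_eq_Suc_imp_eq_union size_1_singleton_mset One_nat_def add_left_cancel plus_1_eq_Suc size_add_mset)
  ultimately show ?thesis using that by simp
qed

definition component_of :: "('v, 'e) mgraph \<Rightarrow> 'v \<Rightarrow> 'v set" where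
  "component_of G v = {w \<in> verts G. (v, w) \<in> (adjacency G)\<^sup>*}"

lemma graph_components_eq: "graph_components G = component_of G ` verts G"
  unfolding graph_components_def component_of_def by blast

lemma sym_adjacency: "sym (adjacency G)"
  unfolding adjacency_def sym_def by (auto simp: add_mset_commute)

lemma component_of_eq: "(v, w) \<in> (adjacency G)\<^sup>* \<Longrightarrow> component_of G v = component_of G w"
  unfolding component_of_def
  using rtrancl_trans symD[OF sym_rtrancl[OF sym_adjacency]] by (metis (no_types, opaque_lifting))

lemma component_of_self: "v \<in> verts G \<Longrightarrow> v \<in> component_of G v"
  unfolding component_of_def by simp

lemma component_of_member: "w \<in> component_of G v \<Longrightarrow> component_of G w = component_of G v"
  using component_of_eq[of v w G] by (simp add: component_of_def)

lemma graph_components_member: "Q \<in> graph_components G \<Longrightarrow> v \<in> Q \<Longrightarrow> Q = component_of G v"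
  unfolding graph_components_eq using component_of_member by (metis imageE)

lemma graph_components_disjoint:
  "Q \<in> graph_components G \<Longrightarrow> Q' \<in> graph_components G \<Longrightarrow> v \<in> Q \<Longrightarrow> v \<in> Q' \<Longrightarrow> Q = Q'"
  using graph_components_member by metis

lemma graph_components_Union: "\<Union>(graph_components G) = verts G"
  using component_of_self[of _ G] unfolding graph_components_eq
  by (auto simp: component_of_def)

lemma finite_graph_components: "finite (verts G) \<Longrightarrow> finite (graph_components G)"
  unfolding graph_components_eq by simp

lemma graph_components_edge:
  assumes "Q \<in> graph_components G" "e \<in> edges G" "ends G e = {#a, b#}" "a \<in> Q" "b \<in> verts G"
  shows "b \<in> Q"
proof -
  have "(a, b) \<in> (adjacency G)\<^sup>*" using assms(2,3) unfolding adjacency_def by blast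
  thus ?thesis using graph_components_member[OF assms(1,4)] assms(5) unfolding component_of_def by blast
qed

lemma adjacency_rtrancl_constant:
  assumes "\<And>e a b. e \<in> edges G \<Longrightarrow> ends G e = {#a, b#} \<Longrightarrow> \<gamma> a = \<gamma> b"
    and "(v, w) \<in> (adjacency G)\<^sup>*"
  shows "\<gamma> v = \<gamma> w"
  using assms(2)
proof induction
  case (step y z)
  thus ?case using assms(1) unfolding adjacency_def by auto
qed simp

lemma multigraph_induced_subgraph: "multigraph G \<Longrightarrow> multigraph (induced_subgraph G R)"
  unfolding multigraph_def induced_subgraph_def by auto

lemma induced_subgraph_simps [simp]:
  "verts (induced_subgraph G R) = verts G \<inter> R"
  "edges (induced_subgraph G R) = {e \<in> edges G. set_mset (ends G e) \<subseteq> R}"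
  "ends (induced_subgraph G R) = ends G"
  unfolding induced_subgraph_def by simp_all

section \<open>Half-edges and degree sums\<close>

lemma edges_between_commute: "edges_between G A B = edges_between G B A"
  unfolding edges_between_def by (auto; metis add_mset_commute)

text \<open>
  The map \<open>en\<close> orients each edge: \<open>en e True\<close> and \<open>en e False\<close> are its two ends, and the pair
  \<open>(e, b)\<close> stands for the half of \<open>e\<close> at \<open>en e b\<close>. A loop thus gives two half-edges at its vertex.
\<close>
definition half_edges :: "('v, 'e) mgraph \<Rightarrow> ('e \<Rightarrow> bool \<Rightarrow> 'v) \<Rightarrow> 'v set \<Rightarrow> ('e \<times> bool) set" where
  "half_edges G en A = {(e, b). e \<in> edges G \<and> en e b \<in> A}"

lemma sum_vertex_degree_half_edges:
  assumes fin: "finite (edges G)" "finite A"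
    and en: "\<And>e. e \<in> edges G \<Longrightarrow> ends G e = {#en e True, en e False#}"
  shows "(\<Sum>v\<in>A. vertex_degree G v) = card (half_edges G en A)"
proof -
  have *: "(\<Sum>v\<in>A. count (ends G e) v) = card {b. en e b \<in> A}" if "e \<in> edges G" for e
  proof -
    have "(\<Sum>v\<in>A. count (ends G e) v) = (\<Sum>v\<in>A. if en e True = v then 1 else 0) + (\<Sum>v\<in>A. if en e False = v then 1 else 0)"
      unfolding en[OF that] by (subst sum.distrib[symmetric]) (auto intro!: sum.cong)
    also have "\<dots> = (if en e True \<in> A then 1 else 0) + (if en e False \<in> A then 1 else 0)"
      using fin(2) by simp
    also have "\<dots> = (\<Sum>b\<in>UNIV. if en e b \<in> A then 1 else 0)" by (simp add: UNIV_bool)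
    also have "\<dots> = card {b. en e b \<in> A}" by (simp add: sum.If_cases)
    finally show ?thesis .
  qed
  have "(\<Sum>v\<in>A. vertex_degree G v) = (\<Sum>e\<in>edges G. \<Sum>v\<in>A. count (ends G e) v)"
    unfolding vertex_degree_def by (rule sum.swap)
  also have "\<dots> = (\<Sum>e\<in>edges G. card {b. en e b \<in> A})" using * by simp
  also have "\<dots> = card (SIGMA e:edges G. {b. en e b \<in> A})" using fin(1) by simp
  also have "(SIGMA e:edges G. {b. en e b \<in> A}) = half_edges G en A"
    unfolding half_edges_def by auto
  finally show ?thesis .
qed

locale oriented_multigraph =
  fixes G :: "('v, 'e) mgraph" and en :: "'e \<Rightarrow> bool \<Rightarrow> 'v"
  assumes mg: "multigraph G"
    and en: "\<And>e. e \<in> edges G \<Longrightarrow> ends G e = {#en e True, en e False#}"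
begin

lemma fin: "finite (verts G)" "finite (edges G)"
  using mg unfolding multigraph_def by auto

lemma finite_half_edges: "finite (half_edges G en A)"
  by (rule finite_subset[of _ "edges G \<times> UNIV"]) (auto simp: half_edges_def fin)

lemma en_verts: "e \<in> edges G \<Longrightarrow> en e b \<in> verts G"
  using mg en[of e] unfolding multigraph_def by (cases b) auto

lemma card_half_edges_between:
  assumes "A \<inter> B = {}"
  shows "card {(e, b). e \<in> edges G \<and> en e b \<in> A \<and> en e (\<not> b) \<in> B} = card (edges_between G A B)"
proof -
  let ?X = "{(e, b). e \<in> edges G \<and> en e b \<in> A \<and> en e (\<not> b) \<in> B}"
  have inj: "inj_on fst ?X"
  proof (rule inj_onI, clarsimp)
    fix e b b' assume "en e b \<in> A" "en e (\<not> b) \<in> B" "en e b' \<in> A" "en e (\<not> b') \<in> B"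
    thus "b = b'" using assms by (cases b; cases b') auto
  qed
  have img: "fst ` ?X = edges_between G A B"
  proof (intro equalityI subsetI)
    fix e assume "e \<in> fst ` ?X"
    then obtain b where b: "e \<in> edges G" "en e b \<in> A" "en e (\<not> b) \<in> B" by auto
    have "ends G e = {#en e b, en e (\<not> b)#}" using en[OF b(1)] by (cases b) (auto simp: add_mset_commute)
    thus "e \<in> edges_between G A B" unfolding edges_between_def using b by blast
  next
    fix e assume "e \<in> edges_between G A B"
    then obtain a b where e: "e \<in> edges G" "a \<in> A" "b \<in> B" "ends G e = {#a, b#}"
      unfolding edges_between_def by blast
    hence "(en e True = a \<and> en e False = b) \<or> (en e True = b \<and> en e False = a)"
      using en[OF e(1)] by (auto simp: add_eq_conv_ex)
    hence "(e, True) \<in> ?X \<or> (e, False) \<in> ?X" using e by auto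
    thus "e \<in> fst ` ?X" by force
  qed
  show ?thesis using card_image[OF inj] unfolding img by simp
qed

end

lemma multigraph_orientation:
  assumes "multigraph G"
  shows "\<exists>en. \<forall>e\<in>edges G. ends G e = {#en e True, en e False#}"
proof -
  have "\<exists>f :: bool \<Rightarrow> 'a. e \<in> edges G \<longrightarrow> ends G e = {#f True, f False#}" for e
  proof (cases "e \<in> edges G")
    case True
    then obtain a b where "ends G e = {#a, b#}" using multigraph_endsD[OF assms] by metis
    thus ?thesis by (intro exI[of _ "\<lambda>x. if x then a else b"]) simp
  qed simp
  hence "\<exists>en. \<forall>e. e \<in> edges G \<longrightarrow> ends G e = {#en e True, en e False#}" by (rule choice[OF allI])
  thus ?thesis by blast
qed

lemma edges_between_iff:
  "ends G e = {#a, b#} \<Longrightarrow> e \<in> edges_between G A B \<longleftrightarrow> e \<in> edges G \<and> (a \<in> A \<and> b \<in> B \<or> b \<in> A \<and> a \<in> B)"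
  unfolding edges_between_def by (auto simp: add_eq_conv_ex)

lemma finite_edges_between: "multigraph G \<Longrightarrow> finite (edges_between G A B)"
  unfolding edges_between_def multigraph_def by auto

text \<open>
  An edge inside \<open>A\<close> has both halves at \<open>A\<close>, an edge leaving \<open>A\<close> has one.
\<close>
lemma degree_sum:
  assumes G: "multigraph G" and A: "finite A"
  shows "(\<Sum>v\<in>A. vertex_degree G v) =
    2 * card {e \<in> edges G. set_mset (ends G e) \<subseteq> A} + card (edges_between G A (- A))"
proof -
  obtain en where orient: "\<forall>e\<in>edges G. ends G e = {#en e True, en e False#}"
    using multigraph_orientation[OF G] by blast
  interpret oriented_multigraph G en by unfold_locales (use G orient in auto)
  let ?B = "{(e, b). e \<in> edges G \<and> en e b \<in> A \<and> en e (\<not> b) \<in> - A}"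
  let ?I = "{e \<in> edges G. set_mset (ends G e) \<subseteq> A}"
  have I: "e \<in> ?I \<longleftrightarrow> e \<in> edges G \<and> (\<forall>b. en e b \<in> A)" for e
    using en[of e] by (auto simp: all_bool_eq)
  have "half_edges G en A = ?B \<union> ?I \<times> UNIV"
  proof (intro equalityI subsetI)
    fix h assume "h \<in> half_edges G en A"
    then obtain e b where h: "h = (e, b)" "e \<in> edges G" "en e b \<in> A" unfolding half_edges_def by auto
    have "h \<in> ?I \<times> UNIV" if "en e (\<not> b) \<in> A"
      using I[of e] h that by (cases b) (auto simp: all_bool_eq)
    thus "h \<in> ?B \<union> ?I \<times> UNIV" using h by blast
  next
    fix h assume "h \<in> ?B \<union> ?I \<times> UNIV"
    thus "h \<in> half_edges G en A" using I unfolding half_edges_def by auto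
  qed
  moreover have "?B \<inter> ?I \<times> UNIV = {}" using I by auto
  moreover have "finite ?B" by (rule finite_subset[OF _ finite_half_edges[of A]]) (auto simp: half_edges_def)
  moreover have "finite (?I \<times> (UNIV :: bool set))" using fin by simp
  ultimately have "card (half_edges G en A) = card ?B + card (?I \<times> (UNIV :: bool set))"
    by (simp only: card_Un_disjoint)
  moreover have "card ?B = card (edges_between G A (- A))" by (rule card_half_edges_between) simp
  moreover have "card (?I \<times> (UNIV :: bool set)) = 2 * card ?I" by (simp add: card_cartesian_product)
  ultimately show ?thesis using sum_vertex_degree_half_edges[OF fin(2) A en] by simp
qed

lemma card_edges_meeting_le_degree_sum:
  assumes G: "multigraph G" and A: "finite A"
  shows "card {e \<in> edges G. set_mset (ends G e) \<inter> A \<noteq> {}} \<le> (\<Sum>v\<in>A. vertex_degree G v)"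
proof -
  let ?I = "{e \<in> edges G. set_mset (ends G e) \<subseteq> A}"
  have "{e \<in> edges G. set_mset (ends G e) \<inter> A \<noteq> {}} \<subseteq> ?I \<union> edges_between G A (- A)"
  proof
    fix e assume e: "e \<in> {e \<in> edges G. set_mset (ends G e) \<inter> A \<noteq> {}}"
    then obtain a b where "ends G e = {#a, b#}" using multigraph_endsD[OF G] by blast
    thus "e \<in> ?I \<union> edges_between G A (- A)" using e edges_between_iff[of G e a b A "- A"] by auto
  qed
  moreover have "finite (?I \<union> edges_between G A (- A))"
    using G finite_edges_between[OF G] unfolding multigraph_def by simp
  ultimately have "card {e \<in> edges G. set_mset (ends G e) \<inter> A \<noteq> {}} \<le> card (?I \<union> edges_between G A (- A))"
    by (rule card_mono[rotated])
  also have "\<dots> \<le> card ?I + card (edges_between G A (- A))" by (rule card_Un_le)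
  also have "\<dots> \<le> (\<Sum>v\<in>A. vertex_degree G v)" unfolding degree_sum[OF G A] by simp
  finally show ?thesis .
qed

lemma component_boundary:
  assumes G: "multigraph G" and Q: "Q \<in> graph_components (induced_subgraph G R)"
  shows "edges_between G Q (- Q) = edges_between G Q (verts G - R)"
proof (intro equalityI subsetI)
  have QR: "Q \<subseteq> verts G \<inter> R" using Q graph_components_Union[of "induced_subgraph G R"] by auto
  {
    fix e assume "e \<in> edges_between G Q (- Q)"
    then obtain a b where e: "e \<in> edges G" "ends G e = {#a, b#}" "a \<in> Q" "b \<notin> Q"
      unfolding edges_between_def by blast
    have b: "b \<in> verts G" using G e unfolding multigraph_def by auto
    have "b \<notin> R"
    proof
      assume "b \<in> R"
      hence "e \<in> edges (induced_subgraph G R)" using e QR by auto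
      from graph_components_edge[OF Q this _ e(3)] show False using e b \<open>b \<in> R\<close> by simp
    qed
    thus "e \<in> edges_between G Q (verts G - R)" unfolding edges_between_def using e b by blast
  next
    fix e assume "e \<in> edges_between G Q (verts G - R)"
    thus "e \<in> edges_between G Q (- Q)" unfolding edges_between_def using QR by blast
  }
qed

lemma edges_between_Un: "edges_between G A (B \<union> C) = edges_between G A B \<union> edges_between G A C"
  unfolding edges_between_def by blast

section \<open>A matching gadget for regular factors\<close>

text \<open>
  In the auxiliary graph the two halves of an edge are adjacent, and each half-edge is adjacent to
  all \<open>l\<close> copies of its vertex. In a perfect matching the edges whose halves are not matched to each
  other form an \<open>l\<close>-factor, since the copies of a vertex absorb exactly \<open>l\<close> half-edges there.
\<close>
locale half_edge_gadget =
  oriented_multigraph G en for G :: "('v, 'e) mgraph" and en :: "'e \<Rightarrow> bool \<Rightarrow> 'v" +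
  fixes l :: nat
  assumes l_pos: "l > 0"
begin

definition gadget_verts :: "('v \<times> nat + 'e \<times> bool) set" where
  "gadget_verts = Inl ` (verts G \<times> {..<l}) \<union> Inr ` (edges G \<times> UNIV)"

definition gadget_edges :: "('v \<times> nat + 'e \<times> bool) set set" where
  "gadget_edges = {{Inr (e, True), Inr (e, False)} | e. e \<in> edges G} \<union>
     {{Inl (en e b, i), Inr (e, b)} | e b i. e \<in> edges G \<and> i < l}"

lemma gadget_edges_wf: "\<forall>m\<in>gadget_edges. m \<subseteq> gadget_verts \<and> card m = 2"
  unfolding gadget_edges_def gadget_verts_def using en_verts by (auto simp: card_insert_if)

lemma finite_gadget_verts: "finite gadget_verts"
  unfolding gadget_verts_def using fin by simp

lemma gadget_copy_edge: "e \<in> edges G \<Longrightarrow> i < l \<Longrightarrow> {Inl (en e b, i), Inr (e, b)} \<in> gadget_edges"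
  unfolding gadget_edges_def by blast

lemma gadget_pair_edge: "e \<in> edges G \<Longrightarrow> {Inr (e, b), Inr (e, \<not> b)} \<in> gadget_edges"
  unfolding gadget_edges_def by (cases b) (auto simp: insert_commute)

lemma gadget_nbr_half_edge:
  "{Inr (e, b), y} \<in> gadget_edges \<Longrightarrow> y = Inr (e, \<not> b) \<or> (\<exists>i<l. y = Inl (en e b, i))"
  unfolding gadget_edges_def by (auto simp: doubleton_eq_iff)

lemma gadget_nbr_copy:
  "{Inl (v, i), y} \<in> gadget_edges \<Longrightarrow> \<exists>e b. e \<in> edges G \<and> en e b = v \<and> y = Inr (e, b)"
  unfolding gadget_edges_def by (auto simp: doubleton_eq_iff)

lemma gadget_copy_edgeD:
  "{Inl (v, i), Inr (e, b)} \<in> gadget_edges \<Longrightarrow> e \<in> edges G \<and> en e b = v \<and> i < l"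
  unfolding gadget_edges_def by (auto simp: doubleton_eq_iff)

lemma gadget_edge_at_copy:
  "m \<in> gadget_edges \<Longrightarrow> Inl (v, i) \<in> m \<Longrightarrow> \<exists>h. m = {Inl (v, i), Inr h}"
  unfolding gadget_edges_def by auto

lemma gadget_edge_at_half_edge:
  "m \<in> gadget_edges \<Longrightarrow> Inr (e, b) \<in> m \<Longrightarrow>
    m = {Inr (e, True), Inr (e, False)} \<or> (\<exists>i. m = {Inl (en e b, i), Inr (e, b)})"
  unfolding gadget_edges_def by auto

lemma has_factor_of_perfect_matching:
  assumes M: "M \<subseteq> gadget_edges" "pairwise disjnt M" "\<Union>M = gadget_verts"
  shows "has_factor l G"
proof -
  define F where "F = G\<lparr>edges := {e \<in> edges G. {Inr (e, True), Inr (e, False)} \<notin> M}\<rparr>"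
  have F: "verts F = verts G" "ends F = ends G"
    "edges F = {e \<in> edges G. {Inr (e, True), Inr (e, False)} \<notin> M}" unfolding F_def by simp_all
  have uniq: "m = m'" if "m \<in> M" "m' \<in> M" "x \<in> m" "x \<in> m'" for m m' x
    using M(2) that unfolding pairwise_def disjnt_def by blast
  have "vertex_degree F v = l" if v: "v \<in> verts G" for v
  proof -
    \<comment> \<open>\<open>P\<close> is the matching between the copies of \<open>v\<close> and the half-edges of \<open>F\<close> at \<open>v\<close>.\<close>
    define P where "P = {(i, h). {Inl (v, i), Inr h} \<in> M}"
    have P: "e \<in> edges G \<and> en e b = v \<and> i < l" if "(i, (e, b)) \<in> P" for i e b
      using that M(1) gadget_copy_edgeD unfolding P_def by blast
    have "fst ` P = {..<l}"
    proof (intro equalityI subsetI)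
      fix i assume "i \<in> fst ` P" thus "i \<in> {..<l}" using P by fastforce
    next
      fix i assume "i \<in> {..<l}"
      hence "Inl (v, i) \<in> \<Union>M" unfolding M(3) gadget_verts_def using v by simp
      then obtain m where m: "m \<in> M" "Inl (v, i) \<in> m" by blast
      then obtain h where "m = {Inl (v, i), Inr h}"
        using M(1) gadget_edge_at_copy by blast
      hence "(i, h) \<in> P" unfolding P_def using m(1) by simp
      thus "i \<in> fst ` P" by force
    qed
    moreover have "inj_on fst P"
    proof (rule inj_onI, clarsimp simp: P_def)
      fix i e b e' b' assume "{Inl (v, i), Inr (e, b)} \<in> M" "{Inl (v, i), Inr (e', b')} \<in> M"
      from uniq[OF this, of "Inl (v, i)"] show "e = e' \<and> b = b'" by (simp add: doubleton_eq_iff)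
    qed
    ultimately have l: "card P = l" by (metis card_image card_lessThan)
    have "snd ` P = half_edges F en {v}"
    proof (intro equalityI subsetI)
      fix h assume "h \<in> snd ` P"
      then obtain i e b where h: "h = (e, b)" "(i, (e, b)) \<in> P" by (metis imageE prod.collapse)
      have "{Inr (e, True), Inr (e, False)} \<notin> M"
      proof
        assume "{Inr (e, True), Inr (e, False)} \<in> M"
        with h(2) uniq[of "{Inl (v, i), Inr (e, b)}" "{Inr (e, True), Inr (e, False)}" "Inr (e, b)"]
        show False unfolding P_def by (cases b) auto
      qed
      thus "h \<in> half_edges F en {v}" using P[OF h(2)] unfolding half_edges_def F h(1) by simp
    next
      fix h assume "h \<in> half_edges F en {v}"
      then obtain e b where h: "h = (e, b)" "e \<in> edges G" "en e b = v"
        "{Inr (e, True), Inr (e, False)} \<notin> M" unfolding half_edges_def F by auto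
      have "Inr (e, b) \<in> \<Union>M" unfolding M(3) gadget_verts_def using h(2) by simp
      then obtain m where m: "m \<in> M" "Inr (e, b) \<in> m" by blast
      then obtain i where "m = {Inl (v, i), Inr (e, b)}"
        using M(1) h(3,4) gadget_edge_at_half_edge by blast
      hence "(i, (e, b)) \<in> P" unfolding P_def using m(1) by simp
      thus "h \<in> snd ` P" using h(1) by force
    qed
    moreover have "inj_on snd P"
    proof (rule inj_onI, clarsimp simp: P_def)
      fix i i' e b assume "{Inl (v, i), Inr (e, b)} \<in> M" "{Inl (v, i'), Inr (e, b)} \<in> M"
      from uniq[OF this, of "Inr (e, b)"] show "i = i'" by (simp add: doubleton_eq_iff)
    qed
    ultimately have "card (half_edges F en {v}) = card P" by (metis card_image)
    moreover have "(\<Sum>v\<in>{v}. vertex_degree F v) = card (half_edges F en {v})"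
      using fin en by (intro sum_vertex_degree_half_edges) (auto simp: F)
    ultimately show ?thesis using l by simp
  qed
  hence "d_regular l F" unfolding d_regular_def F by simp
  moreover have "spanning_subgraph F G" unfolding spanning_subgraph_def F by auto
  ultimately show ?thesis unfolding has_factor_def by blast
qed

lemma gadget_barrier:
  assumes "\<not> has_factor l G"
  shows "\<exists>U. \<exists>c :: 'v \<times> nat + 'e \<times> bool \<Rightarrow> ('v \<times> nat + 'e \<times> bool) set.
    barrier gadget_verts gadget_edges U c"
proof -
  obtain M U and c :: "'v \<times> nat + 'e \<times> bool \<Rightarrow> ('v \<times> nat + 'e \<times> bool) set"
    where M: "M \<subseteq> gadget_edges" "pairwise disjnt M" and U: "U \<subseteq> gadget_verts"
      and c: "\<forall>x y. {x, y} \<in> gadget_edges \<longrightarrow> x \<notin> U \<longrightarrow> y \<notin> U \<longrightarrow> c x = c y"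
      and card: "card gadget_verts + card U \<le> 2 * card M + card (odd_classes (gadget_verts - U) c)"
    using tutte_berge_labelling[OF finite_gadget_verts gadget_edges_wf] by blast
  have M': "finite M" "\<forall>m\<in>M. card m = 2" "\<Union>M \<subseteq> gadget_verts"
    using M(1) gadget_edges_wf finite_gadget_verts
    by (auto intro: finite_subset[of M "Pow gadget_verts"])
  have "\<Union>M \<noteq> gadget_verts" using has_factor_of_perfect_matching M assms by blast
  hence "2 * card M < card gadget_verts"
    using M' finite_gadget_verts card_Union_matching[OF M'(1) M(2) M'(2)] psubset_card_mono by (metis psubsetI)
  hence "card U < card (odd_classes (gadget_verts - U) c)" using card by linarith
  thus ?thesis unfolding barrier_def using U c by blast
qed

text \<open>
  Take a barrier \<open>U\<close> of least size. If \<open>U\<close> contains a half-edge at \<open>v\<close>, that half-edge has neighbours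
  with two different labels among the copies of \<open>v\<close>, so no half-edge at \<open>v\<close> can be outside \<open>U\<close>. If
  \<open>U\<close> contains a copy of \<open>v\<close>, it likewise contains all copies. Hence \<open>U\<close> consists of the copies of
  \<open>S\<close> and of the half-edges at \<open>T\<close>. What remains of the auxiliary graph falls into single copies of
  vertices of \<open>T\<close>, single halves of edges between \<open>S\<close> and \<open>T\<close>, pairs of halves of edges inside
  \<open>S\<close>, and one piece for each component of \<open>G[R]\<close>; counting the odd pieces gives the inequality.
\<close>
lemma no_factor_witness:
  assumes "\<not> has_factor l G"
  shows "\<exists>S T. S \<subseteq> verts G \<and> T \<subseteq> verts G \<and> S \<inter> T = {} \<and>
    l * card S + (\<Sum>v\<in>T. vertex_degree G v) <
    l * card T + card (edges_between G S T) +
    card {Q \<in> graph_components (induced_subgraph G (verts G - S - T)).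
      odd (l * card Q + card (edges_between G T Q))}"
proof -
  define isb where "isb = (\<lambda>(U, c :: 'v \<times> nat + 'e \<times> bool \<Rightarrow> ('v \<times> nat + 'e \<times> bool) set).
    barrier gadget_verts gadget_edges U c)"
  obtain U0 c0 where "isb (U0, c0)" using gadget_barrier[OF assms] unfolding isb_def by auto
  from ex_has_least_nat[of isb, OF this, of "\<lambda>(U, c). card U"]
  obtain U and c :: "'v \<times> nat + 'e \<times> bool \<Rightarrow> ('v \<times> nat + 'e \<times> bool) set"
    where bar: "barrier gadget_verts gadget_edges U c"
      and min: "\<And>U' c'. isb (U', c') \<Longrightarrow> card U \<le> card U'" by (auto simp: isb_def)
  have nbr: "\<exists>y\<in>gadget_verts - U. {x, y} \<in> gadget_edges \<and> c y \<noteq> i \<and> c y \<noteq> j"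
    if "x \<in> U" for x i j
    using minimal_barrier_neighbour[OF finite_gadget_verts gadget_edges_wf bar _ that] min
    unfolding isb_def by auto
  have UV: "U \<subseteq> gadget_verts"
    and cE: "\<And>x y. {x, y} \<in> gadget_edges \<Longrightarrow> x \<notin> U \<Longrightarrow> y \<notin> U \<Longrightarrow> c x = c y"
    and cardU: "card U < card (odd_classes (gadget_verts - U) c)"
    using bar unfolding barrier_def by auto
  have half_in_U: "(\<exists>i<l. Inl (en e b, i) \<notin> U) \<and> (\<forall>e'\<in>edges G. \<forall>b'. en e' b' = en e b \<longrightarrow> Inr (e', b') \<in> U)"
    if eb: "Inr (e, b) \<in> U" for e b
  proof -
    obtain y1 where y1: "y1 \<notin> U" "{Inr (e, b), y1} \<in> gadget_edges" "c y1 \<noteq> c (Inr (e, \<not> b))"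
      using nbr[OF eb, where i = "c (Inr (e, \<not> b))" and j = "c (Inr (e, \<not> b))"] by auto
    obtain y2 where y2: "y2 \<notin> U" "{Inr (e, b), y2} \<in> gadget_edges" "c y2 \<noteq> c (Inr (e, \<not> b))" "c y2 \<noteq> c y1"
      using nbr[OF eb, where i = "c (Inr (e, \<not> b))" and j = "c y1"] by auto
    obtain i j where ij: "y1 = Inl (en e b, i)" "i < l" "y2 = Inl (en e b, j)" "j < l"
      using gadget_nbr_half_edge[OF y1(2)] gadget_nbr_half_edge[OF y2(2)] y1(3) y2(3) by blast
    have "Inr (e', b') \<in> U" if "e' \<in> edges G" "en e' b' = en e b" for e' b'
    proof (rule ccontr)
      assume "Inr (e', b') \<notin> U"
      hence "c y1 = c (Inr (e', b'))" "c y2 = c (Inr (e', b'))"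
        using cE gadget_copy_edge[OF that(1), of _ b'] y1(1) y2(1) ij that(2) by metis+
      thus False using y2(4) by simp
    qed
    thus ?thesis using ij y1(1) by blast
  qed
  have copy_in_U: "\<forall>j<l. Inl (v, j) \<in> U" if vi: "Inl (v, i) \<in> U" for v i
  proof (intro allI impI, rule ccontr)
    fix j assume j: "j < l" "Inl (v, j) \<notin> U"
    obtain y where y: "y \<notin> U" "{Inl (v, i), y} \<in> gadget_edges" "c y \<noteq> c (Inl (v, j))"
      using nbr[OF vi, where i = "c (Inl (v, j))" and j = "c (Inl (v, j))"] by auto
    obtain e b where eb: "e \<in> edges G" "en e b = v" "y = Inr (e, b)"
      using gadget_nbr_copy[OF y(2)] by blast
    have "c (Inl (v, j)) = c y"
      using cE[OF gadget_copy_edge[OF eb(1) j(1), of b]] j y(1) eb by simp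
    thus False using y(3) by simp
  qed
  define S where "S = {v \<in> verts G. \<exists>i. Inl (v, i) \<in> U}"
  \<comment> \<open>Isolated vertices count as having all their half-edges in \<open>U\<close>, so they belong to \<open>T\<close> unless
    their copies are in \<open>U\<close>; hence all copies of a vertex in \<open>R\<close> have a common neighbour.\<close>
  define T where "T = {v \<in> verts G. v \<notin> S \<and> (\<forall>e\<in>edges G. \<forall>b. en e b = v \<longrightarrow> Inr (e, b) \<in> U)}"
  define R where "R = verts G - S - T"
  have disj: "S \<inter> T = {}" "R \<inter> S = {}" "R \<inter> T = {}" unfolding T_def R_def by auto
  have sub: "S \<subseteq> verts G" "T \<subseteq> verts G" "R \<subseteq> verts G" unfolding S_def T_def R_def by auto
  have RST: "v \<in> R \<or> v \<in> S \<or> v \<in> T" if "v \<in> verts G" for v using that unfolding R_def by blast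
  have finS: "finite S" "finite T" "finite R" using sub fin finite_subset by blast+
  have copyU: "Inl (v, i) \<in> U \<longleftrightarrow> v \<in> S \<and> i < l" for v i
    using copy_in_U UV unfolding S_def gadget_verts_def by auto
  have halfU: "Inr (e, b) \<in> U \<longleftrightarrow> e \<in> edges G \<and> en e b \<in> T" for e b
  proof
    assume eb: "Inr (e, b) \<in> U"
    hence e: "e \<in> edges G" using UV unfolding gadget_verts_def by auto
    have "en e b \<notin> S" using half_in_U[OF eb] copyU by blast
    thus "e \<in> edges G \<and> en e b \<in> T" using half_in_U[OF eb] en_verts[OF e] e unfolding T_def by blast
  next
    assume "e \<in> edges G \<and> en e b \<in> T" thus "Inr (e, b) \<in> U" unfolding T_def by blast
  qed
  have "U = Inl ` (S \<times> {..<l}) \<union> Inr ` half_edges G en T"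
  proof (intro equalityI subsetI)
    fix x assume "x \<in> U" thus "x \<in> Inl ` (S \<times> {..<l}) \<union> Inr ` half_edges G en T"
      by (cases x) (auto simp: copyU halfU half_edges_def)
  qed (auto simp: copyU halfU half_edges_def)
  hence "card U = card (Inl ` (S \<times> {..<l}) :: ('v \<times> nat + 'e \<times> bool) set)
      + card (Inr ` half_edges G en T :: ('v \<times> nat + 'e \<times> bool) set)"
    using finS finite_half_edges by (simp only:) (rule card_Un_disjoint, auto)
  hence cU: "card U = l * card S + (\<Sum>v\<in>T. vertex_degree G v)"
    using sum_vertex_degree_half_edges[OF fin(2) finS(2) en]
    by (simp add: card_image card_cartesian_product)
  let ?H = "induced_subgraph G R"
  let ?\<Q> = "graph_components ?H"
  have vH: "verts ?H = R" using sub by auto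
  note comp_self = component_of_self[of _ ?H, unfolded vH]
  have comp_in: "component_of ?H v \<in> ?\<Q>" if "v \<in> R" for v
    using that unfolding graph_components_eq vH by simp
  define \<gamma> where "\<gamma> v = c (Inl (v, 0))" for v
  have half_label: "c (Inr (e, b)) = c (Inl (en e b, i))" if "e \<in> edges G" "en e b \<in> R" "i < l" for e b i
  proof -
    have "en e b \<notin> S" "en e b \<notin> T" using that(2) disj by blast+
    thus ?thesis using cE[OF gadget_copy_edge[OF that(1,3), of b]] by (simp add: copyU halfU)
  qed
  have half_\<gamma>: "c (Inr (e, b)) = \<gamma> (en e b)" if "e \<in> edges G" "en e b \<in> R" for e b
    using half_label[OF that l_pos] unfolding \<gamma>_def .
  have copy_\<gamma>: "c (Inl (v, i)) = \<gamma> v" if v: "v \<in> R" "i < l" for v i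
  proof -
    obtain e b where "e \<in> edges G" "en e b = v" using v(1) unfolding R_def T_def by blast
    thus ?thesis using half_label[of e b i] half_\<gamma>[of e b] v by simp
  qed
  have \<gamma>_edge: "\<gamma> a = \<gamma> b" if "e \<in> edges ?H" "ends ?H e = {#a, b#}" for e a b
  proof -
    have e: "e \<in> edges G" "a \<in> R" "b \<in> R" "ends G e = {#a, b#}" using that by auto
    have ab: "(en e True = a \<and> en e False = b) \<or> (en e True = b \<and> en e False = a)"
      using en[OF e(1)] e(4) by (auto simp: add_eq_conv_ex)
    have "{Inr (e, True), Inr (e, False)} \<in> gadget_edges" using gadget_pair_edge[OF e(1), of True] by simp
    from cE[OF this] have "c (Inr (e, True)) = c (Inr (e, False))"
      using ab e disj halfU by blast
    thus ?thesis using half_\<gamma>[OF e(1), of True] half_\<gamma>[OF e(1), of False] ab e by auto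
  qed
  \<comment> \<open>\<open>\<pi>\<close> labels the pieces of the auxiliary graph without \<open>U\<close>, an edge inside \<open>S\<close> being represented
    by its half \<open>(e, True)\<close>. The labelling \<open>c\<close> factors through \<open>\<pi>\<close> by means of \<open>g\<close>.\<close>
  define g where "g z = (case z of Inl x \<Rightarrow> c x | Inr Q \<Rightarrow> \<gamma> (SOME v. v \<in> Q))" for z
  have g_comp: "g (Inr (component_of ?H v)) = \<gamma> v" if "v \<in> R" for v
  proof -
    have "(SOME w. w \<in> component_of ?H v) \<in> component_of ?H v"
      using comp_self[OF that] by (rule someI)
    hence adj: "(v, SOME w. w \<in> component_of ?H v) \<in> (adjacency ?H)\<^sup>*"
      by (simp add: component_of_def)
    have "\<gamma> v = \<gamma> (SOME w. w \<in> component_of ?H v)"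
      by (rule adjacency_rtrancl_constant[OF _ adj]) (rule \<gamma>_edge)
    thus ?thesis unfolding g_def by simp
  qed
  define \<pi> where "\<pi> x = (case x of
      Inl (v, i) \<Rightarrow> if v \<in> T then Inl x else Inr (component_of ?H v)
    | Inr (e, b) \<Rightarrow>
        if en e b \<in> R then Inr (component_of ?H (en e b))
        else if en e (\<not> b) \<in> R then Inr (component_of ?H (en e (\<not> b)))
        else if en e (\<not> b) \<in> T then Inl x else Inl (Inr (e, True)))"
    for x :: "'v \<times> nat + 'e \<times> bool"
  let ?W = "gadget_verts - U"
  have W_copy: "Inl (v, i) \<in> ?W \<longleftrightarrow> (v \<in> T \<or> v \<in> R) \<and> i < l" for v i
    using copyU sub disj RST[of v] unfolding gadget_verts_def by auto
  have W_half: "Inr (e, b) \<in> ?W \<longleftrightarrow> e \<in> edges G \<and> (en e b \<in> S \<or> en e b \<in> R)" for e b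
    using halfU disj RST[OF en_verts, of e b] unfolding gadget_verts_def by auto
  have fac: "c x = g (\<pi> x)" if x: "x \<in> ?W" for x
  proof (cases x)
    case (Inl vi)
    then obtain v i where vi: "x = Inl (v, i)" by (cases vi) auto
    show ?thesis
      using x W_copy[of v i] copy_\<gamma>[of v i] g_comp[of v] unfolding vi \<pi>_def by (auto simp: g_def)
  next
    case (Inr eb)
    then obtain e b where eb: "x = Inr (e, b)" by (cases eb) auto
    have e: "e \<in> edges G" and S: "en e b \<in> S \<or> en e b \<in> R" using x W_half unfolding eb by auto
    have same: "c (Inr (e, b)) = c (Inr (e, \<not> b))" if "en e b \<notin> T" "en e (\<not> b) \<notin> T"
      using cE[OF gadget_pair_edge[OF e]] halfU that by blast
    consider "en e b \<in> R" | "en e b \<notin> R" "en e (\<not> b) \<in> R" | "en e b \<notin> R" "en e (\<not> b) \<in> T"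
      | "en e b \<notin> R" "en e (\<not> b) \<notin> R" "en e (\<not> b) \<notin> T" by blast
    thus ?thesis
    proof cases
      case 1 thus ?thesis using half_\<gamma>[OF e] g_comp unfolding eb \<pi>_def by simp
    next
      case 2
      hence "c (Inr (e, b)) = c (Inr (e, \<not> b))" using same S disj by blast
      thus ?thesis using 2 half_\<gamma>[OF e] g_comp unfolding eb \<pi>_def by simp
    next
      case 3 thus ?thesis using disj unfolding eb \<pi>_def g_def by auto
    next
      case 4
      hence "c (Inr (e, b)) = c (Inr (e, \<not> b))" using same S disj by blast
      hence "c (Inr (e, b)) = c (Inr (e, True))" by (cases b) auto
      thus ?thesis using 4 unfolding eb \<pi>_def g_def by simp
    qed
  qed
  let ?odd = "{Q \<in> ?\<Q>. odd (l * card Q + card (edges_between G T Q))}"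
  let ?ST = "{(e, b). e \<in> edges G \<and> en e b \<in> S \<and> en e (\<not> b) \<in> T}"
  have comp_class: "Q \<in> ?odd"
    if Q: "Q \<in> ?\<Q>" and odd: "odd (card {x \<in> ?W. \<pi> x = Inr Q})" for Q
  proof -
    have QR: "Q \<subseteq> R" using Q graph_components_Union[of ?H] vH by blast
    have compQ: "component_of ?H v = Q \<longleftrightarrow> v \<in> Q" if "v \<in> R" for v
      using graph_components_member[OF Q, of v] comp_self[OF that] by auto
    \<comment> \<open>The half-edges in the piece of \<open>Q\<close> come in pairs, both halves of an edge in \<open>X\<close>, except for the
      set \<open>A\<close> of those whose other half lies at \<open>T\<close>. So their number has the parity of \<open>e(T, Q)\<close>.\<close>
    define A where "A = {(e, b). e \<in> edges G \<and> en e b \<in> Q \<and> en e (\<not> b) \<in> T}"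
    define X where "X = {e \<in> edges G. (en e True \<in> Q \<and> en e False \<in> Q \<union> S) \<or> (en e False \<in> Q \<and> en e True \<in> Q \<union> S)}"
    have stay: "en e (\<not> b) \<in> Q" if "e \<in> edges G" "en e b \<in> Q" "en e (\<not> b) \<in> R" for e b
    proof -
      have "ends G e = {#en e b, en e (\<not> b)#}"
        using en[OF that(1)] by (cases b) (auto simp: add_mset_commute)
      thus ?thesis using graph_components_edge[OF Q, of e "en e b" "en e (\<not> b)"] that QR vH by auto
    qed
    have finA: "finite A"
      by (rule finite_subset[of _ "edges G \<times> UNIV"]) (auto simp: A_def fin)
    have finX: "finite X" unfolding X_def using fin by simp
    have finQ: "finite Q" using QR finS(3) by (rule finite_subset)
    have AX: "A \<inter> X \<times> UNIV = {}"
    proof -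
      have "en e b \<notin> T" if "e \<in> X" for e b
        using that QR disj unfolding X_def by (cases b) auto
      thus ?thesis unfolding A_def by auto
    qed
    have "{x \<in> ?W. \<pi> x = Inr Q} = Inl ` (Q \<times> {..<l}) \<union> Inr ` (A \<union> X \<times> UNIV)"
    proof (intro equalityI subsetI)
      fix x assume x: "x \<in> {x \<in> ?W. \<pi> x = Inr Q}"
      show "x \<in> Inl ` (Q \<times> {..<l}) \<union> Inr ` (A \<union> X \<times> UNIV)"
      proof (cases x)
        case (Inl vi)
        then obtain v i where vi: "x = Inl (v, i)" by (cases vi) auto
        have "v \<in> R \<and> i < l \<and> component_of ?H v = Q"
          using x W_copy[of v i] unfolding vi by (auto simp: \<pi>_def split: if_splits)
        thus ?thesis unfolding vi using compQ by blast
      next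
        case (Inr eb)
        then obtain e b where eb: "x = Inr (e, b)" by (cases eb) auto
        have e: "e \<in> edges G" and S: "en e b \<in> S \<or> en e b \<in> R" using x W_half unfolding eb by auto
        have "en e b \<in> Q \<or> en e b \<in> S \<and> en e (\<not> b) \<in> Q"
          using x S compQ unfolding eb \<pi>_def by (auto split: if_splits)
        moreover have "en e (\<not> b) \<in> Q \<or> en e (\<not> b) \<in> S \<or> en e (\<not> b) \<in> T" if "en e b \<in> Q"
          using stay[OF e that] RST[OF en_verts[OF e]] by blast
        ultimately have "(e, b) \<in> A \<union> X \<times> UNIV" using e unfolding A_def X_def by (cases b) auto
        thus ?thesis unfolding eb by blast
      qed
    next
      fix x assume x: "x \<in> Inl ` (Q \<times> {..<l}) \<union> Inr ` (A \<union> X \<times> UNIV)"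
      show "x \<in> {x \<in> ?W. \<pi> x = Inr Q}"
      proof (cases x)
        case (Inl vi)
        then obtain v i where vi: "x = Inl (v, i)" by (cases vi) auto
        have v: "v \<in> Q" "i < l" using x unfolding vi by auto
        hence "v \<in> R" "v \<notin> T" using QR disj by blast+
        thus ?thesis using W_copy[of v i] v compQ[of v] unfolding vi by (simp add: \<pi>_def)
      next
        case (Inr eb)
        then obtain e b where eb: "x = Inr (e, b)" by (cases eb) auto
        have "(e, b) \<in> A \<union> X \<times> UNIV" using x unfolding eb by auto
        hence e: "e \<in> edges G" and "en e b \<in> Q \<or> en e b \<in> S \<and> en e (\<not> b) \<in> Q"
          unfolding A_def X_def by (cases b; auto)+
        thus ?thesis
        proof (elim disjE)
          assume "en e b \<in> Q"
          moreover from this have "en e b \<in> R" using QR by blast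
          ultimately show ?thesis using e W_half[of e b] compQ unfolding eb by (simp add: \<pi>_def)
        next
          assume *: "en e b \<in> S \<and> en e (\<not> b) \<in> Q"
          hence "en e b \<notin> R" "en e (\<not> b) \<in> R" using QR disj by blast+
          thus ?thesis using e W_half[of e b] compQ * unfolding eb by (simp add: \<pi>_def)
        qed
      qed
    qed
    hence "card {x \<in> ?W. \<pi> x = Inr Q} = card (Inl ` (Q \<times> {..<l}) \<union> Inr ` (A \<union> X \<times> UNIV) ::
        ('v \<times> nat + 'e \<times> bool) set)" by (rule arg_cong)
    also have "\<dots> = card (Inl ` (Q \<times> {..<l}) :: ('v \<times> nat + 'e \<times> bool) set)
        + card (Inr ` (A \<union> X \<times> UNIV) :: ('v \<times> nat + 'e \<times> bool) set)"
      using finQ finA finX by (intro card_Un_disjoint) auto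
    also have "\<dots> = card Q * l + card (A \<union> X \<times> UNIV)"
      by (simp add: card_image card_cartesian_product)
    also have "card (A \<union> X \<times> UNIV) = card A + card (X \<times> (UNIV :: bool set))"
      using finA finX AX by (intro card_Un_disjoint) auto
    also have "card (X \<times> (UNIV :: bool set)) = card X * 2" by (simp add: card_cartesian_product)
    finally have "card {x \<in> ?W. \<pi> x = Inr Q} = card Q * l + (card A + card X * 2)" .
    hence "odd (l * card Q + card A)" using odd by (simp add: mult.commute)
    moreover have "card A = card (edges_between G Q T)"
      unfolding A_def using QR disj by (intro card_half_edges_between) blast
    ultimately show ?thesis using Q edges_between_commute[of G Q T] by simp
  qed
  have odd_sub: "odd_classes ?W \<pi> \<subseteq> Inl ` (Inl ` (T \<times> {..<l}) \<union> Inr ` ?ST) \<union> Inr ` ?odd"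
  proof
    fix j assume j: "j \<in> odd_classes ?W \<pi>"
    hence odd: "odd (card {x \<in> ?W. \<pi> x = j})" unfolding odd_classes_def by simp
    obtain x where x: "x \<in> ?W" "\<pi> x = j"
      using subsetD[OF odd_classes_subset_image j] by (elim imageE) simp
    have *: "j \<in> Inl ` (Inl ` (T \<times> {..<l}) \<union> Inr ` ?ST) \<union> Inr ` ?odd"
      if "j = Inr (component_of ?H v)" "v \<in> R" for v
      using comp_class[OF comp_in[OF that(2)]] odd unfolding that(1) by blast
    show "j \<in> Inl ` (Inl ` (T \<times> {..<l}) \<union> Inr ` ?ST) \<union> Inr ` ?odd"
    proof (cases x)
      case (Inl vi)
      then obtain v i where vi: "x = Inl (v, i)" by (cases vi) auto
      have "v \<in> T \<and> i < l \<and> j = Inl x \<or> v \<in> R \<and> j = Inr (component_of ?H v)"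
        using x W_copy[of v i] disj unfolding vi by (cases "v \<in> T") (simp_all add: \<pi>_def)
      thus ?thesis using * vi by blast
    next
      case (Inr eb)
      then obtain e b where eb: "x = Inr (e, b)" by (cases eb) auto
      have e: "e \<in> edges G" and S: "en e b \<in> S \<or> en e b \<in> R" using x W_half unfolding eb by auto
      consider "en e b \<in> R" | "en e b \<in> S" "en e (\<not> b) \<in> R" | "en e b \<in> S" "en e (\<not> b) \<in> T"
        | "en e b \<in> S" "en e (\<not> b) \<in> S" using S RST[OF en_verts[OF e]] by blast
      thus ?thesis
      proof cases
        case 1 thus ?thesis using *[of "en e b"] x(2) unfolding eb \<pi>_def by simp
      next
        case 2
        moreover from this have "en e b \<notin> R" using disj by blast
        ultimately show ?thesis using *[of "en e (\<not> b)"] x(2) unfolding eb \<pi>_def by simp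
      next
        case 3
        moreover from this have "en e b \<notin> R" "en e (\<not> b) \<notin> R" using disj by blast+
        ultimately have "j = Inl x" using x(2) unfolding eb \<pi>_def by simp
        thus ?thesis using 3 e eb by blast
      next
        case 4
        hence nR: "en e b' \<in> S" "en e b' \<notin> R" "en e b' \<notin> T" for b' using disj by (cases "b' = b"; auto)+
        have jx: "j = Inl (Inr (e, True))" using x(2) nR unfolding eb \<pi>_def by simp
        have "{x \<in> ?W. \<pi> x = j} = {Inr (e, True), Inr (e, False)}"
        proof (intro equalityI subsetI)
          fix z assume "z \<in> {x \<in> ?W. \<pi> x = j}"
          hence z: "z \<in> ?W" "\<pi> z = Inl (Inr (e, True))" using jx by auto
          show "z \<in> {Inr (e, True), Inr (e, False)}"
          proof (cases z)
            case (Inl vi) thus ?thesis using z(2) by (auto simp: \<pi>_def split: if_splits prod.splits)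
          next
            case (Inr eb') 
            then obtain e' b' where eb': "z = Inr (e', b')" by (cases eb') auto
            have "e' = e" using z(2) unfolding eb' by (auto simp: \<pi>_def split: if_splits)
            thus ?thesis unfolding eb' by (cases b') auto
          qed
        next
          fix z :: "'v \<times> nat + 'e \<times> bool"
          assume "z \<in> {Inr (e, True), Inr (e, False)}"
          then obtain b' where "z = Inr (e, b')" by blast
          thus "z \<in> {x \<in> ?W. \<pi> x = j}" using nR W_half[of e b'] e jx by (simp add: \<pi>_def)
        qed
        hence "card {x \<in> ?W. \<pi> x = j} = 2" by simp
        with odd show ?thesis by simp
      qed
    qed
  qed
  have finST: "finite ?ST" by (rule finite_subset[of _ "edges G \<times> UNIV"]) (auto simp: fin)
  have finodd: "finite ?odd" using finite_graph_components[of ?H] vH finS(3) by simp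
  have "card (odd_classes ?W c) \<le> card (odd_classes ?W \<pi>)"
    using finite_gadget_verts fac by (intro card_odd_classes_le_refinement[where g = g]) auto
  also have "\<dots> \<le> card (Inl ` (Inl ` (T \<times> {..<l}) \<union> Inr ` ?ST) \<union> Inr ` ?odd ::
      (('v \<times> nat + 'e \<times> bool) + 'v set) set)"
    using odd_sub finS(2) finST finodd by (intro card_mono) auto
  also have "\<dots> \<le> card (Inl ` (Inl ` (T \<times> {..<l}) \<union> Inr ` ?ST) :: (('v \<times> nat + 'e \<times> bool) + 'v set) set)
      + card (Inr ` ?odd :: (('v \<times> nat + 'e \<times> bool) + 'v set) set)" by (rule card_Un_le)
  also have "\<dots> \<le> (card (Inl ` (T \<times> {..<l}) :: ('v \<times> nat + 'e \<times> bool) set) + card (Inr ` ?ST :: ('v \<times> nat + 'e \<times> bool) set))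
      + card ?odd"
    using card_Un_le[of "Inl ` (T \<times> {..<l}) :: ('v \<times> nat + 'e \<times> bool) set" "Inr ` ?ST"]
    by (simp add: card_image)
  also have "\<dots> = l * card T + card (edges_between G S T) + card ?odd"
    using card_half_edges_between[OF disj(1)] by (simp add: card_image card_cartesian_product)
  finally have "card (odd_classes ?W c) \<le> l * card T + card (edges_between G S T) + card ?odd" .
  with cardU cU have "l * card S + (\<Sum>v\<in>T. vertex_degree G v) < l * card T + card (edges_between G S T) + card ?odd"
    by linarith
  thus ?thesis using sub disj(1) unfolding R_def by blast
qed

end

section \<open>The criterion for regular factors\<close>

text \<open>
  Let \<open>F\<close> be an \<open>l\<close>-factor. For a component \<open>Q\<close> with \<open>l |Q| + e(T, Q)\<close> odd, the edges of \<open>F\<close> leaving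
  \<open>Q\<close> cannot be exactly those between \<open>T\<close> and \<open>Q\<close>, so some edge at \<open>Q\<close> is in \<open>F\<close> and meets \<open>S\<close> or is
  not in \<open>F\<close> and meets \<open>T\<close>; different components give different edges. Each edge between \<open>S\<close> and \<open>T\<close> is also of one of these two kinds. There
  are at most \<open>l |S|\<close> edges of the first kind, and at most \<open>(\<Sum>v\<in>T. deg v) - l |T|\<close> of the second.
\<close>
theorem regular_factor_inequality:
  assumes G: "multigraph G" and fac: "has_factor l G"
    and ST: "S \<subseteq> verts G" "T \<subseteq> verts G" "S \<inter> T = {}"
  shows "l * card T + card (edges_between G S T) +
      card {Q \<in> graph_components (induced_subgraph G (verts G - S - T)).
        odd (l * card Q + card (edges_between G T Q))}
    \<le> l * card S + (\<Sum>v\<in>T. vertex_degree G v)"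
proof -
  let ?R = "verts G - S - T"
  let ?\<Q> = "graph_components (induced_subgraph G ?R)"
  let ?odd = "{Q \<in> ?\<Q>. odd (l * card Q + card (edges_between G T Q))}"
  obtain F0 where F0: "spanning_subgraph F0 G" "d_regular l F0" using fac unfolding has_factor_def by blast
  define E where "E = edges F0"
  have E: "E \<subseteq> edges G" using F0(1) unfolding E_def spanning_subgraph_def by blast
  define F where "F = G\<lparr>edges := E\<rparr>"
  define K where "K = G\<lparr>edges := edges G - E\<rparr>"
  have Fs: "verts F = verts G" "edges F = E" "ends F = ends G" unfolding F_def by simp_all
  have Ks: "verts K = verts G" "edges K = edges G - E" "ends K = ends G" unfolding K_def by simp_all
  have mF: "multigraph F" "multigraph K"
    using G E unfolding multigraph_def Fs Ks by (auto intro: finite_subset)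
  have finV: "finite (verts G)" "finite (edges G)" using G unfolding multigraph_def by auto
  have finST: "finite S" "finite T" using ST finV finite_subset by blast+
  have degF: "vertex_degree F v = l" if "v \<in> verts G" for v
  proof -
    have "vertex_degree F v = vertex_degree F0 v"
      using F0(1) unfolding vertex_degree_def Fs E_def spanning_subgraph_def by (auto intro: sum.cong)
    thus ?thesis using F0 that unfolding d_regular_def spanning_subgraph_def by simp
  qed
  have degK: "vertex_degree G v = vertex_degree K v + vertex_degree F v" for v
    unfolding vertex_degree_def Fs Ks using E finV(2) by (rule sum.subset_diff)
  have sumF: "(\<Sum>v\<in>A. vertex_degree F v) = l * card A" if "A \<subseteq> verts G" for A
    using that degF by (simp add: subset_iff mult.commute)
  have QR: "Q \<subseteq> ?R" if "Q \<in> ?\<Q>" for Q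
    using that graph_components_Union[of "induced_subgraph G ?R"] by auto
  have ex: "\<exists>e. e \<in> edges_between F Q S \<or> e \<in> edges_between K Q T" if Q: "Q \<in> ?odd" for Q
  proof (rule ccontr)
    assume no: "\<nexists>e. e \<in> edges_between F Q S \<or> e \<in> edges_between K Q T"
    have Q': "Q \<in> ?\<Q>" using Q by blast
    have "verts G - ?R = S \<union> T" using ST by blast
    hence "edges_between G Q (- Q) = edges_between G Q S \<union> edges_between G Q T"
      using component_boundary[OF G Q'] edges_between_Un by metis
    hence "edges_between F Q (- Q) = edges_between G Q T"
      using no E unfolding edges_between_def Fs Ks by blast
    moreover have "finite Q" using QR[OF Q'] finV finite_subset by blast
    moreover have "Q \<subseteq> verts G" using QR[OF Q'] by blast
    ultimately have eq: "l * card Q = 2 * card {e \<in> edges F. set_mset (ends F e) \<subseteq> Q} + card (edges_between G Q T)"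
      using degree_sum[OF mF(1), of Q] sumF[of Q] by simp
    have "odd (l * card Q + card (edges_between G T Q))" using Q by blast
    thus False unfolding eq edges_between_commute[of G Q T] by simp
  qed
  define \<psi> where "\<psi> Q = (SOME e. e \<in> edges_between F Q S \<or> e \<in> edges_between K Q T)" for Q
  have \<psi>: "\<psi> Q \<in> edges_between F Q S \<or> \<psi> Q \<in> edges_between K Q T" if "Q \<in> ?odd" for Q
    unfolding \<psi>_def using ex[OF that] by (rule someI_ex)
  have \<psi>_end: "\<exists>q\<in>Q. \<exists>s\<in>S \<union> T. ends G (\<psi> Q) = {#q, s#}" if "Q \<in> ?odd" for Q
    using \<psi>[OF that] unfolding edges_between_def Fs Ks by blast
  have inj: "inj_on \<psi> ?odd"
  proof (rule inj_onI)
    fix Q Q' assume Q: "Q \<in> ?odd" "Q' \<in> ?odd" "\<psi> Q = \<psi> Q'"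
    obtain q s where q: "q \<in> Q" "s \<in> S \<union> T" "ends G (\<psi> Q) = {#q, s#}" using \<psi>_end[OF Q(1)] by blast
    obtain q' s' where q': "q' \<in> Q'" "s' \<in> S \<union> T" "ends G (\<psi> Q) = {#q', s'#}"
      using \<psi>_end[OF Q(2)] Q(3) by auto
    have "q \<in> ?R" "q' \<in> ?R" using q q' QR Q by blast+
    hence "q = q'" using q q' by (auto simp: add_eq_conv_ex)
    hence qQ': "q \<in> Q'" using q'(1) by simp
    have "Q \<in> ?\<Q>" "Q' \<in> ?\<Q>" using Q(1,2) by blast+
    from graph_components_disjoint[OF this q(1) qQ'] show "Q = Q'" .
  qed
  let ?Z = "edges_between G S T \<union> \<psi> ` ?odd"
  let ?X = "{e \<in> edges F. set_mset (ends F e) \<inter> S \<noteq> {}}"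
  let ?Y = "{e \<in> edges K. set_mset (ends K e) \<inter> T \<noteq> {}}"
  have "edges_between G S T \<inter> \<psi> ` ?odd = {}"
  proof -
    have False if Q: "Q \<in> ?odd" and e: "\<psi> Q \<in> edges_between G S T" for Q
    proof -
      obtain q s where q: "q \<in> Q" "s \<in> S \<union> T" "ends G (\<psi> Q) = {#q, s#}" using \<psi>_end[OF Q] by blast
      have "q \<in> ?R" using q QR Q by blast
      thus False using e edges_between_iff[OF q(3), of S T] by blast
    qed
    thus ?thesis by blast
  qed
  moreover have finodd: "finite ?odd" using finite_graph_components[of "induced_subgraph G ?R"] finV by simp
  ultimately have cZ: "card ?Z = card (edges_between G S T) + card ?odd"
    using card_image[OF inj] finite_edges_between[OF G] by (subst card_Un_disjoint) auto
  have sub: "?Z \<subseteq> ?X \<union> ?Y"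
  proof -
    have "edges_between G S T \<subseteq> ?X \<union> ?Y" unfolding edges_between_def Fs Ks by auto
    moreover have "edges_between F Q S \<subseteq> ?X" "edges_between K Q T \<subseteq> ?Y" for Q
      unfolding edges_between_def by auto
    hence "\<psi> ` ?odd \<subseteq> ?X \<union> ?Y" using \<psi> by blast
    ultimately show ?thesis by blast
  qed
  have "finite (?X \<union> ?Y)" using mF unfolding multigraph_def by simp
  from card_mono[OF this sub] have "card (edges_between G S T) + card ?odd \<le> card (?X \<union> ?Y)"
    unfolding cZ .
  also have "\<dots> \<le> card ?X + card ?Y" by (rule card_Un_le)
  also have "\<dots> \<le> (\<Sum>v\<in>S. vertex_degree F v) + (\<Sum>v\<in>T. vertex_degree K v)"
    by (intro add_mono card_edges_meeting_le_degree_sum mF finST)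
  finally show ?thesis using sumF[OF ST(1)] sumF[OF ST(2)] degK by (simp add: sum.distrib)
qed

text \<open>
  The theorem of Belck and Tutte. The gadget needs at least one copy of each vertex; for \<open>l = 0\<close> the
  edgeless subgraph is a factor.
\<close>
theorem regular_factor_theorem:
  assumes G: "multigraph G"
  shows "has_factor l G \<longleftrightarrow> (\<forall>S T. S \<subseteq> verts G \<longrightarrow> T \<subseteq> verts G \<longrightarrow> S \<inter> T = {} \<longrightarrow>
    l * card T + card (edges_between G S T) +
      card {Q \<in> graph_components (induced_subgraph G (verts G - S - T)).
        odd (l * card Q + card (edges_between G T Q))}
    \<le> l * card S + (\<Sum>v\<in>T. vertex_degree G v))" (is "_ \<longleftrightarrow> ?R")
proof
  assume "has_factor l G" thus ?R using regular_factor_inequality[OF G] by blast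
next
  assume R: ?R
  show "has_factor l G"
  proof (cases "l = 0")
    case True
    have "spanning_subgraph (G\<lparr>edges := {}\<rparr>) G" "d_regular 0 (G\<lparr>edges := {}\<rparr>)"
      unfolding spanning_subgraph_def d_regular_def vertex_degree_def by auto
    thus ?thesis unfolding has_factor_def True by blast
  next
    case False
    obtain en where orient: "\<forall>e\<in>edges G. ends G e = {#en e True, en e False#}"
      using multigraph_orientation[OF G] by blast
    interpret half_edge_gadget G en l by unfold_locales (use G orient False in auto)
    show ?thesis
    proof (rule ccontr)
      assume "\<not> has_factor l G"
      from no_factor_witness[OF this] R show False by (meson not_less)
    qed
  qed
qed

section \<open>Cut-edges as edge cuts of size one\<close>

lemma delete_edge_simps [simp]:
  "verts (delete_edge G e) = verts G" "edges (delete_edge G e) = edges G - {e}"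
  "ends (delete_edge G e) = ends G"
  unfolding delete_edge_def by simp_all

text \<open>
  If deleting \<open>e\<close> separates its ends, take for \<open>X\<close> what one end still reaches. Conversely, the
  components after deletion map onto those before, and the two containing the ends of \<open>e\<close> have the
  same image.
\<close>
lemma cut_edge_iff:
  assumes G: "multigraph G"
  shows "e \<in> cut_edges G \<longleftrightarrow> (\<exists>X. edges_between G X (- X) = {e})"
proof
  let ?D = "delete_edge G e"
  assume e: "e \<in> cut_edges G"
  hence eG: "e \<in> edges G" and lt: "card (graph_components G) < card (graph_components ?D)"
    unfolding cut_edges_def by auto
  obtain u v where uv: "ends G e = {#u, v#}" using multigraph_endsD[OF G eG] .
  define X where "X = {w. (u, w) \<in> (adjacency ?D)\<^sup>*}"
  have "v \<notin> X"
  proof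
    assume "v \<in> X"
    hence uvD: "(u, v) \<in> (adjacency ?D)\<^sup>*" unfolding X_def by simp
    have vuD: "(v, u) \<in> (adjacency ?D)\<^sup>*" using symD[OF sym_rtrancl[OF sym_adjacency] uvD] .
    have "adjacency G \<subseteq> (adjacency ?D)\<^sup>*"
    proof clarify
      fix a b assume "(a, b) \<in> adjacency G"
      then obtain e' where e': "e' \<in> edges G" "ends G e' = {#a, b#}" unfolding adjacency_def by blast
      show "(a, b) \<in> (adjacency ?D)\<^sup>*"
      proof (cases "e' = e")
        case True
        hence "a = u \<and> b = v \<or> a = v \<and> b = u" using e' uv by (auto simp: add_eq_conv_ex)
        thus ?thesis using uvD vuD by blast
      next
        case False
        hence "(a, b) \<in> adjacency ?D" using e' unfolding adjacency_def by auto
        thus ?thesis by blast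
      qed
    qed
    hence "(adjacency G)\<^sup>* \<subseteq> (adjacency ?D)\<^sup>*" by (rule rtrancl_subset_rtrancl)
    moreover have "adjacency ?D \<subseteq> adjacency G" unfolding adjacency_def by auto
    hence "(adjacency ?D)\<^sup>* \<subseteq> (adjacency G)\<^sup>*" by (rule rtrancl_mono)
    ultimately have "(adjacency ?D)\<^sup>* = (adjacency G)\<^sup>*" by blast
    hence "graph_components ?D = graph_components G" unfolding graph_components_def by simp
    thus False using lt by simp
  qed
  have "edges_between G X (- X) = {e}"
  proof (intro equalityI subsetI)
    fix e' assume "e' \<in> edges_between G X (- X)"
    then obtain a b where e': "e' \<in> edges G" "ends G e' = {#a, b#}" "a \<in> X" "b \<notin> X"
      unfolding edges_between_def by blast
    show "e' \<in> {e}"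
    proof (rule ccontr)
      assume "e' \<notin> {e}"
      hence "(a, b) \<in> adjacency ?D" using e' unfolding adjacency_def by auto
      hence "b \<in> X" using e'(3) unfolding X_def by (auto intro: rtrancl_into_rtrancl)
      thus False using e'(4) by blast
    qed
  next
    fix e' assume "e' \<in> {e}"
    moreover have "u \<in> X" unfolding X_def by simp
    ultimately show "e' \<in> edges_between G X (- X)" using eG uv \<open>v \<notin> X\<close> unfolding edges_between_def by blast
  qed
  thus "\<exists>X. edges_between G X (- X) = {e}" by blast
next
  let ?D = "delete_edge G e"
  assume "\<exists>X. edges_between G X (- X) = {e}"
  then obtain X where X: "edges_between G X (- X) = {e}" by blast
  hence "e \<in> edges_between G X (- X)" by blast
  then obtain u v where e: "e \<in> edges G" "ends G e = {#u, v#}" "u \<in> X" "v \<notin> X"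
    unfolding edges_between_def by blast
  have uvG: "u \<in> verts G" "v \<in> verts G" using G e unfolding multigraph_def by auto
  have sub: "(adjacency ?D)\<^sup>* \<subseteq> (adjacency G)\<^sup>*"
    by (rule rtrancl_mono) (auto simp: adjacency_def)
  have const: "(a \<in> X) = (b \<in> X)" if "e' \<in> edges ?D" "ends ?D e' = {#a, b#}" for e' a b
  proof -
    have e': "e' \<in> edges G" "ends G e' = {#a, b#}" "e' \<noteq> e" using that by auto
    have "e' \<notin> edges_between G X (- X)" using X e'(3) by blast
    thus ?thesis using edges_between_iff[OF e'(2), of X "- X"] e'(1) by blast
  qed
  have notD: "(u, v) \<notin> (adjacency ?D)\<^sup>*"
  proof
    assume uv: "(u, v) \<in> (adjacency ?D)\<^sup>*"
    have "(u \<in> X) = (v \<in> X)"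
      by (rule adjacency_rtrancl_constant[where \<gamma> = "\<lambda>w. w \<in> X", OF _ uv]) (rule const)
    thus False using e by blast
  qed
  define h where "h P = component_of G (SOME w. w \<in> P)" for P
  have h: "h (component_of ?D w) = component_of G w" if "w \<in> verts G" for w
  proof -
    have "(SOME x. x \<in> component_of ?D w) \<in> component_of ?D w"
      by (rule someI[of _ w]) (use component_of_self[of w ?D] that in simp)
    hence "(w, SOME x. x \<in> component_of ?D w) \<in> (adjacency G)\<^sup>*"
      using sub by (auto simp: component_of_def)
    thus ?thesis unfolding h_def by (rule component_of_eq[symmetric])
  qed
  have img: "h ` graph_components ?D = graph_components G"
    unfolding graph_components_eq using h by (simp add: image_image)
  have finD: "finite (graph_components ?D)"
    using G finite_graph_components[of ?D] unfolding multigraph_def by simp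
  have "\<not> inj_on h (graph_components ?D)"
  proof
    assume inj: "inj_on h (graph_components ?D)"
    have "(u, v) \<in> (adjacency G)\<^sup>*" using e unfolding adjacency_def by blast
    hence "h (component_of ?D u) = h (component_of ?D v)" using h uvG component_of_eq by metis
    hence "component_of ?D u = component_of ?D v"
      using inj uvG unfolding graph_components_eq inj_on_def by auto
    hence "v \<in> component_of ?D u" using component_of_self[of v ?D] uvG by simp
    thus False using notD unfolding component_of_def by simp
  qed
  hence "card (graph_components G) \<noteq> card (graph_components ?D)"
    using eq_card_imp_inj_on[OF finD, of h] unfolding img by blast
  moreover have "card (graph_components G) \<le> card (graph_components ?D)"
    using card_image_le[OF finD, of h] unfolding img .
  ultimately show "e \<in> cut_edges G" unfolding cut_edges_def using e(1) by simp
qed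

lemma boundary_iff:
  "ends G e = {#a, b#} \<Longrightarrow> e \<in> edges_between G X (- X) \<longleftrightarrow> e \<in> edges G \<and> (a \<in> X) \<noteq> (b \<in> X)"
  by (auto simp: edges_between_iff)

lemma vertex_degree_inside:
  assumes G: "multigraph G" and v: "v \<in> Q"
  shows "vertex_degree G v = (\<Sum>e\<in>{e \<in> edges G. set_mset (ends G e) \<subseteq> Q}. count (ends G e) v)
    + (\<Sum>e\<in>edges_between G Q (- Q). count (ends G e) v)"
proof -
  let ?I = "{e \<in> edges G. set_mset (ends G e) \<subseteq> Q}" and ?B = "edges_between G Q (- Q)"
  have fin: "finite (edges G)" "finite ?I" "finite ?B"
    using G finite_edges_between[OF G] unfolding multigraph_def by auto
  have "vertex_degree G v = (\<Sum>e\<in>?I \<union> ?B. count (ends G e) v)"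
    unfolding vertex_degree_def
  proof (rule sum.mono_neutral_right)
    show "?I \<union> ?B \<subseteq> edges G" unfolding edges_between_def by blast
    show "\<forall>e\<in>edges G - (?I \<union> ?B). count (ends G e) v = 0"
    proof
      fix e assume e: "e \<in> edges G - (?I \<union> ?B)"
      then obtain a b where ab: "ends G e = {#a, b#}" using multigraph_endsD[OF G] by blast
      have "a \<notin> Q" "b \<notin> Q" using e boundary_iff[OF ab, of Q] ab by auto
      thus "count (ends G e) v = 0" using v ab by auto
    qed
  qed (rule fin)
  also have "?I \<inter> ?B = {}" unfolding edges_between_def by auto
  hence "(\<Sum>e\<in>?I \<union> ?B. count (ends G e) v) = (\<Sum>e\<in>?I. count (ends G e) v) + (\<Sum>e\<in>?B. count (ends G e) v)"
    using fin by (intro sum.union_disjoint)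
  finally show ?thesis .
qed

text \<open>
  An edge cut \<open>X\<close> of \<open>G[Q]\<close> may be replaced by \<open>X \<inter> Q\<close>, and no edge of \<open>G\<close> leaves \<open>Q\<close>.
\<close>
lemma cut_edge_of_closed_part:
  assumes G: "multigraph G" and closed: "edges_between G Q (- Q) = {}"
    and e: "e \<in> cut_edges (induced_subgraph G Q)"
  shows "e \<in> cut_edges G"
proof -
  let ?H = "induced_subgraph G Q"
  obtain X where X: "edges_between ?H X (- X) = {e}"
    using e cut_edge_iff[OF multigraph_induced_subgraph[OF G]] by blast
  have "e' \<in> edges_between G (X \<inter> Q) (- (X \<inter> Q)) \<longleftrightarrow> e' \<in> edges_between ?H X (- X)" for e'
  proof (cases "e' \<in> edges G")
    case True
    then obtain a b where ab: "ends G e' = {#a, b#}" using multigraph_endsD[OF G] by blast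
    have "a \<in> Q \<longleftrightarrow> b \<in> Q" using closed boundary_iff[OF ab, of Q] True by blast
    thus ?thesis
      using boundary_iff[OF ab, of "X \<inter> Q"] boundary_iff[of ?H e' a b X] ab True by auto
  qed (auto simp: edges_between_def)
  hence "edges_between G (X \<inter> Q) (- (X \<inter> Q)) = {e}" using X by blast
  thus ?thesis using cut_edge_iff[OF G] by blast
qed

section \<open>Counting over a partition R, S, T\<close>

locale factor_partition =
  fixes G :: "('v, 'e) mgraph" and R S T :: "'v set"
  assumes mg: "multigraph G"
    and cover: "R \<union> S \<union> T = verts G"
    and disj: "R \<inter> S = {}" "R \<inter> T = {}" "S \<inter> T = {}"
begin

abbreviation comps :: "'v set set" where
  "comps \<equiv> graph_components (induced_subgraph G R)"

abbreviation to_S :: "'v set \<Rightarrow> nat" where "to_S Q \<equiv> card (edges_between G S Q)"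
abbreviation to_T :: "'v set \<Rightarrow> nat" where "to_T Q \<equiv> card (edges_between G T Q)"

lemma fin: "finite (verts G)" "finite (edges G)" "finite R" "finite S" "finite T"
proof -
  show "finite (verts G)" "finite (edges G)" using mg unfolding multigraph_def by auto
  thus "finite R" "finite S" "finite T" using cover by (metis finite_Un)+
qed

lemma verts_Int_R [simp]: "verts G \<inter> R = R" using cover by auto

lemma finite_comps: "finite comps"
  using finite_graph_components[of "induced_subgraph G R"] fin by simp

lemma comps_Union: "\<Union>comps = R"
  using graph_components_Union[of "induced_subgraph G R"] by simp

lemma comp_subset: "Q \<in> comps \<Longrightarrow> Q \<subseteq> R" using comps_Union by blast

lemma comp_boundary:
  assumes "Q \<in> comps"
  shows "edges_between G Q (- Q) = edges_between G S Q \<union> edges_between G T Q"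
    and "edges_between G (S \<union> T) Q = edges_between G S Q \<union> edges_between G T Q"
proof -
  have "verts G - R = S \<union> T" using cover disj by blast
  thus "edges_between G Q (- Q) = edges_between G S Q \<union> edges_between G T Q"
    using component_boundary[OF mg assms] edges_between_Un edges_between_commute by metis
  show "edges_between G (S \<union> T) Q = edges_between G S Q \<union> edges_between G T Q"
    unfolding edges_between_def by blast
qed

lemma comp_unique:
  assumes "Q \<in> comps" "Q' \<in> comps" "A \<inter> R = {}" "B \<inter> R = {}"
    and "e \<in> edges_between G A Q" "e \<in> edges_between G B Q'"
  shows "Q = Q'"
proof -
  obtain a q where q: "ends G e = {#a, q#}" "a \<in> A" "q \<in> Q"
    using assms(5) unfolding edges_between_def by blast
  obtain a' q' where q': "ends G e = {#a', q'#}" "a' \<in> B" "q' \<in> Q'"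
    using assms(6) unfolding edges_between_def by blast
  have "q \<in> R" "q' \<in> R" using q q' comp_subset assms(1,2) by blast+
  hence "q = q'" using q q' assms(3,4) by (auto simp: add_eq_conv_ex)
  hence "q \<in> Q'" using q' by simp
  from graph_components_disjoint[OF assms(1,2) q(3) this] show ?thesis .
qed

lemma card_boundary_split:
  assumes AB: "A = S \<and> B = T \<or> A = T \<and> B = S"
  shows "card (edges_between G A (- A)) = card (edges_between G S T)
    + (\<Sum>Q\<in>comps. card (edges_between G A Q))"
proof -
  have d: "A \<inter> B = {}" "A \<inter> R = {}" "B \<inter> R = {}" and c: "verts G = A \<union> B \<union> R"
    using AB disj cover by auto
  have "edges_between G A (- A) = edges_between G A B \<union> (\<Union>Q\<in>comps. edges_between G A Q)"
  proof (intro equalityI subsetI)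
    fix e assume "e \<in> edges_between G A (- A)"
    then obtain a b where e: "e \<in> edges G" "ends G e = {#a, b#}" "a \<in> A" "b \<notin> A"
      unfolding edges_between_def by blast
    have "b \<in> verts G" using mg e unfolding multigraph_def by auto
    hence "b \<in> B \<or> b \<in> \<Union>comps" using c e(4) comps_Union by blast
    thus "e \<in> edges_between G A B \<union> (\<Union>Q\<in>comps. edges_between G A Q)"
      using e unfolding edges_between_def by blast
  next
    fix e assume "e \<in> edges_between G A B \<union> (\<Union>Q\<in>comps. edges_between G A Q)"
    moreover have "B \<subseteq> - A" "\<And>Q. Q \<in> comps \<Longrightarrow> Q \<subseteq> - A" using d comp_subset by blast+
    ultimately show "e \<in> edges_between G A (- A)" unfolding edges_between_def by blast
  qed
  moreover have "edges_between G A B \<inter> (\<Union>Q\<in>comps. edges_between G A Q) = {}"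
  proof -
    have "e \<notin> edges_between G A B" if Q: "Q \<in> comps" and e: "e \<in> edges_between G A Q" for Q e
    proof -
      obtain a q where q: "ends G e = {#a, q#}" "a \<in> A" "q \<in> Q"
        using e unfolding edges_between_def by blast
      have "q \<in> R" using q comp_subset[OF Q] by blast
      thus ?thesis using edges_between_iff[OF q(1), of A B] q d by blast
    qed
    thus ?thesis by blast
  qed
  moreover have "card (\<Union>Q\<in>comps. edges_between G A Q) = (\<Sum>Q\<in>comps. card (edges_between G A Q))"
  proof (rule card_UN_disjoint)
    show "\<forall>Q\<in>comps. \<forall>Q'\<in>comps. Q \<noteq> Q' \<longrightarrow> edges_between G A Q \<inter> edges_between G A Q' = {}"
      using comp_unique[OF _ _ d(2) d(2)] by blast
  qed (use finite_comps finite_edges_between[OF mg] in auto)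
  ultimately have "card (edges_between G A (- A)) = card (edges_between G A B)
    + (\<Sum>Q\<in>comps. card (edges_between G A Q))"
    using finite_edges_between[OF mg] finite_comps by (simp add: card_Un_disjoint)
  moreover have "edges_between G A B = edges_between G S T"
    using AB edges_between_commute[of G S T] by auto
  ultimately show ?thesis by simp
qed

lemma pendant_component:
  assumes Q: "Q \<in> comps" and "to_T Q = 1" "to_S Q = 0"
  shows "\<exists>e\<in>cut_edges G. edges_between G T Q = {e} \<and> edges_between G (S \<union> T) Q = {e}"
proof -
  obtain e where e: "edges_between G T Q = {e}" using assms(2) by (auto simp: card_1_singleton_iff)
  have "edges_between G S Q = {}" using assms(3) finite_edges_between[OF mg] by simp
  hence "edges_between G Q (- Q) = {e}" "edges_between G (S \<union> T) Q = {e}"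
    using comp_boundary[OF Q] e by auto
  moreover from this(1) have "e \<in> cut_edges G" using cut_edge_iff[OF mg] by blast
  ultimately show ?thesis using e by blast
qed

text \<open>
  Sending a component to the only edge that leaves it is an injection into the cut-edges; when the
  two numbers agree it is onto.
\<close>
lemma pendant_components_cut_edges:
  defines "P \<equiv> {Q \<in> comps. to_T Q = 1 \<and> to_S Q = 0}"
  shows "card P \<le> card (cut_edges G)"
    and "card P = card (cut_edges G) \<Longrightarrow> e \<in> cut_edges G \<Longrightarrow> \<exists>Q\<in>P. e \<in> edges_between G T Q"
proof -
  define \<epsilon> where "\<epsilon> Q = (SOME e. e \<in> edges_between G T Q)" for Q
  have \<epsilon>: "\<epsilon> Q \<in> cut_edges G \<and> \<epsilon> Q \<in> edges_between G T Q" if QP: "Q \<in> P" for Q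
  proof -
    obtain e where e: "e \<in> cut_edges G" "edges_between G T Q = {e}"
      using pendant_component[of Q] QP unfolding P_def by auto
    thus ?thesis unfolding \<epsilon>_def by simp
  qed
  have inj: "inj_on \<epsilon> P"
  proof (rule inj_onI)
    fix Q Q' assume Q: "Q \<in> P" "Q' \<in> P" "\<epsilon> Q = \<epsilon> Q'"
    have "T \<inter> R = {}" using disj by blast
    with comp_unique[of Q Q' T T "\<epsilon> Q"] \<epsilon>[OF Q(1)] \<epsilon>[OF Q(2)] Q show "Q = Q'"
      unfolding P_def by simp
  qed
  have fincut: "finite (cut_edges G)" using fin unfolding cut_edges_def by simp
  have sub: "\<epsilon> ` P \<subseteq> cut_edges G" using \<epsilon> by blast
  show "card P \<le> card (cut_edges G)" using card_inj_on_le[OF inj sub fincut] .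
  assume eq: "card P = card (cut_edges G)" and e: "e \<in> cut_edges G"
  have "\<epsilon> ` P = cut_edges G"
    using card_image[OF inj] eq by (intro card_subset_eq[OF fincut sub]) simp
  with e obtain Q where "Q \<in> P" "e = \<epsilon> Q" by blast
  thus "\<exists>Q\<in>P. e \<in> edges_between G T Q" using \<epsilon>[of Q] by blast
qed

text \<open>
  Let \<open>H\<close> be \<open>G[Q]\<close> with the extra edge joining \<open>p\<close> and \<open>q\<close>. An edge cut of size one in \<open>H\<close> can be
  complemented within \<open>Q\<close> so that \<open>q\<close> is not in it. The extra edge then crosses it in \<open>H\<close> iff the edge
  \<open>f\<close> from \<open>S\<close> to \<open>p\<close> crosses it in \<open>G\<close>, and the edge from \<open>T\<close> to \<open>q\<close> does not cross it. So it is an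
  edge cut of \<open>G\<close> consisting of the same edge, which does not join \<open>T\<close> to \<open>R\<close>.
\<close>
lemma blister_if_single_edges:
  assumes reg: "d_regular d G" and cut: "cut_edges G \<subseteq> edges_between G T R"
    and Q: "Q \<in> comps" and x: "to_T Q = 1" and y: "to_S Q = 1"
  shows "blister d G S T Q"
proof -
  obtain f where f: "edges_between G S Q = {f}" using y by (auto simp: card_1_singleton_iff)
  obtain g where g: "edges_between G T Q = {g}" using x by (auto simp: card_1_singleton_iff)
  have "f \<in> edges_between G S Q" using f by simp
  then obtain s p where sp: "f \<in> edges G" "s \<in> S" "p \<in> Q" "ends G f = {#s, p#}"
    unfolding edges_between_def by blast
  have "g \<in> edges_between G T Q" using g by simp
  then obtain t q where tq: "g \<in> edges G" "t \<in> T" "q \<in> Q" "ends G g = {#t, q#}"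
    unfolding edges_between_def by blast
  have QR: "Q \<subseteq> R" using comp_subset[OF Q] .
  have st: "s \<notin> R" "t \<notin> R" "s \<notin> Q" "t \<notin> Q" "s \<noteq> t" using sp tq disj QR by blast+
  have pq: "p \<in> R" "q \<in> R" using sp tq QR by blast+
  have fg: "f \<noteq> g" using sp tq st pq by (auto simp: add_eq_conv_ex)
  have bd: "edges_between G Q (- Q) = {f, g}" using comp_boundary(1)[OF Q] f g by blast
  have bd': "edges_between G Q (S \<union> T) = {f, g}"
    using comp_boundary(2)[OF Q] f g edges_between_commute[of G Q "S \<union> T"] by blast
  define H where "H = add_edge (induced_subgraph G Q) f p q"
  let ?I = "{e \<in> edges G. set_mset (ends G e) \<subseteq> Q}"
  have H: "verts H = verts G \<inter> Q" "edges H = insert f ?I" "ends H = (ends G)(f := {#p, q#})"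
    unfolding H_def add_edge_def by simp_all
  have fI: "f \<notin> ?I" using sp st by auto
  have QG: "Q \<subseteq> verts G" using QR cover by blast
  have mH: "multigraph H"
    using multigraph_induced_subgraph[OF mg, of Q] sp tq QG unfolding multigraph_def H by auto
  have "d_regular d H"
    unfolding d_regular_def
  proof
    fix v assume "v \<in> verts H"
    hence v: "v \<in> Q" "v \<in> verts G" unfolding H by auto
    have "vertex_degree H v = count {#p, q#} v + (\<Sum>e\<in>?I. count (ends H e) v)"
      unfolding vertex_degree_def H(2) using fI fin(2) by (simp add: H(3))
    also have "(\<Sum>e\<in>?I. count (ends H e) v) = (\<Sum>e\<in>?I. count (ends G e) v)"
      using fI by (intro sum.cong) (auto simp: H(3))
    also have "count {#p, q#} v = (\<Sum>e\<in>edges_between G Q (- Q). count (ends G e) v)"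
      unfolding bd using fg sp tq st v by auto
    also have "\<dots> + (\<Sum>e\<in>?I. count (ends G e) v) = vertex_degree G v"
      unfolding vertex_degree_inside[OF mg v(1)] by simp
    finally show "vertex_degree H v = d" using reg v unfolding d_regular_def by simp
  qed
  moreover have "cut_edges H = {}"
  proof (rule ccontr)
    assume "cut_edges H \<noteq> {}"
    then obtain e where e: "e \<in> cut_edges H" by blast
    then obtain X0 where X0: "edges_between H X0 (- X0) = {e}" using cut_edge_iff[OF mH] by blast
    define X where "X = (if q \<in> X0 then Q - X0 else Q \<inter> X0)"
    have XQ: "X \<subseteq> Q" "q \<notin> X" unfolding X_def by auto
    have "e' \<in> edges_between H X (- X) \<longleftrightarrow> e' \<in> edges_between H X0 (- X0)" for e'
    proof (cases "e' \<in> edges H")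
      case True
      then obtain a b where ab: "ends H e' = {#a, b#}" "a \<in> Q" "b \<in> Q"
        using multigraph_endsD[OF mH] unfolding H(1) by blast
      show ?thesis unfolding boundary_iff[OF ab(1)] X_def using ab by auto
    qed (auto simp: edges_between_def)
    hence HX: "edges_between H X (- X) = {e}" using X0 by blast
    have "e' \<in> edges_between G X (- X) \<longleftrightarrow> e' \<in> edges_between H X (- X)" for e'
    proof -
      consider "e' = f" | "e' \<in> ?I" "e' \<noteq> f" | "e' \<notin> ?I" "e' \<noteq> f" by blast
      thus ?thesis
      proof cases
        case 1
        have "ends H f = {#p, q#}" by (simp add: H(3))
        moreover have "s \<notin> X" using st XQ by blast
        ultimately show ?thesis
          unfolding 1 using boundary_iff[OF sp(4), of X] boundary_iff[of H f p q X] sp(1) XQ(2)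
          by (simp add: H(2))
      next
        case 2
        then obtain a b where ab: "ends G e' = {#a, b#}" using multigraph_endsD[OF mg] by blast
        hence "ends H e' = {#a, b#}" using 2 by (simp add: H(3))
        thus ?thesis using boundary_iff[OF ab, of X] boundary_iff[of H e' a b X] 2 by (simp add: H(2))
      next
        case 3
        have "e' \<notin> edges_between G X (- X)"
        proof
          assume e': "e' \<in> edges_between G X (- X)"
          then obtain a b where ab: "e' \<in> edges G" "ends G e' = {#a, b#}" "a \<in> X"
            unfolding edges_between_def by blast
          have "b \<notin> Q" using 3(1) ab XQ by auto
          hence "e' \<in> edges_between G Q (- Q)" using boundary_iff[OF ab(2), of Q] ab XQ by blast
          hence "e' = g" using bd 3(2) by blast
          moreover have "t \<notin> X" using st XQ by blast
          ultimately show False using e' boundary_iff[OF tq(4), of X] XQ(2) by blast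
        qed
        moreover have "e' \<notin> edges_between H X (- X)" using 3 unfolding edges_between_def H(2) by blast
        ultimately show ?thesis by blast
      qed
    qed
    hence "edges_between G X (- X) = {e}" using HX by blast
    hence "e \<in> cut_edges G" using cut_edge_iff[OF mg] by blast
    hence "e \<in> edges_between G T R" using cut by blast
    then obtain t' b' where t': "t' \<in> T" "b' \<in> R" "ends G e = {#t', b'#}" unfolding edges_between_def by blast
    have "e = f \<or> e \<in> ?I" using e unfolding cut_edges_def H(2) by blast
    thus False
    proof
      assume "e = f"
      hence "t' = s \<or> t' = p" using t' sp by (auto simp: add_eq_conv_ex)
      thus False using t'(1) sp(2) pq disj by blast
    next
      assume "e \<in> ?I"
      hence "t' \<in> R" using t' QR by auto
      thus False using t'(1) disj by blast
    qed
  qed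
  ultimately show ?thesis unfolding blister_def H_def using fg bd' sp tq by blast
qed

lemma isolated_component_no_cut_edges:
  assumes reg: "d_regular d G" and cut: "cut_edges G \<subseteq> edges_between G T R"
    and Q: "Q \<in> comps" and x: "to_T Q = 0" and y: "to_S Q = 0"
  shows "d_regular d (induced_subgraph G Q) \<and> cut_edges (induced_subgraph G Q) = {}"
proof
  have bd: "edges_between G Q (- Q) = {}"
    using comp_boundary(1)[OF Q] x y finite_edges_between[OF mg] by simp
  show "d_regular d (induced_subgraph G Q)"
    unfolding d_regular_def
  proof
    fix v assume "v \<in> verts (induced_subgraph G Q)"
    hence v: "v \<in> Q" "v \<in> verts G" by auto
    have "vertex_degree (induced_subgraph G Q) v = vertex_degree G v"
      unfolding vertex_degree_inside[OF mg v(1)] bd by (simp add: vertex_degree_def)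
    thus "vertex_degree (induced_subgraph G Q) v = d" using reg v unfolding d_regular_def by simp
  qed
  show "cut_edges (induced_subgraph G Q) = {}"
  proof (rule ccontr)
    assume "cut_edges (induced_subgraph G Q) \<noteq> {}"
    then obtain e where e: "e \<in> cut_edges (induced_subgraph G Q)" by blast
    hence "set_mset (ends G e) \<subseteq> Q" unfolding cut_edges_def by simp
    moreover have "e \<in> edges_between G T R" using cut_edge_of_closed_part[OF mg bd e] cut by blast
    then obtain t b where "t \<in> T" "ends G e = {#t, b#}" unfolding edges_between_def by blast
    ultimately have "t \<in> R" "t \<in> T" using comp_subset[OF Q] by auto
    thus False using disj by blast
  qed
qed

text \<open>
  The degree sums of \<open>S\<close> and \<open>T\<close> and the parity of the violated inequality give two lower bounds:
  \<open>2 k D + (\<Sum>Q. [x odd] - x) - 2 e(T) \<ge> 2\<close> and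
  \<open>(2 k - 2 r - 1) D + (\<Sum>Q. [x odd] - y) - 2 e(S) \<ge> 2\<close>, where \<open>e(S)\<close> and \<open>e(T)\<close> count the edges
  inside \<open>S\<close> and \<open>T\<close>. The first bound plus twice the second involves each component through
  \<open>3 [x odd] - x - 2 y\<close>, where \<open>x = to_T Q\<close> and \<open>y = to_S Q\<close>, which is at most twice the indicator of \<open>(x, y) = (1, 0)\<close>. As at most
  \<open>2 r + 4 - 3 k\<close> components are of that type, no slack is left anywhere.
\<close>
lemma tight_structure:
  assumes reg: "d_regular (2 * r + 1) G" and k: "k > 0" "3 * k \<le> 2 * r + 1"
    and cuts: "card (cut_edges G) = 2 * r + 4 - 3 * k"
    and viol: "2 * k * card S + (\<Sum>v\<in>T. vertex_degree G v) <
      2 * k * card T + card (edges_between G S T) +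
      card {Q \<in> comps. odd (2 * k * card Q + to_T Q)}"
  shows "card S < card T" and "independent_set G S" and "independent_set G T"
    and "\<And>Q. Q \<in> comps \<Longrightarrow> (to_T Q, to_S Q) \<in> {(0, 0), (1, 0), (1, 1), (3, 0)}"
    and "card {Q \<in> comps. to_T Q = 1 \<and> to_S Q = 0} = card (cut_edges G)"
    and "card {Q \<in> comps. to_T Q = 3} = k * (card T - card S) - 1"
    and "3 * k < 2 * r + 1 \<Longrightarrow> card T - card S = 1"
proof -
  define ob :: "'v set \<Rightarrow> int" where "ob Q = of_bool (odd (to_T Q))" for Q
  define pend :: "'v set \<Rightarrow> int" where "pend Q = of_bool (to_T Q = 1 \<and> to_S Q = 0)" for Q
  define X where "X = (\<Sum>Q\<in>comps. int (to_T Q))"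
  define Y where "Y = (\<Sum>Q\<in>comps. int (to_S Q))"
  define O' where "O' = (\<Sum>Q\<in>comps. ob Q)"
  define A where "A = (\<Sum>Q\<in>comps. pend Q)"
  define W where "W = (\<Sum>Q\<in>comps. 2 * pend Q - 3 * ob Q + int (to_T Q) + 2 * int (to_S Q))"
  define iS where "iS = int (card {e \<in> edges G. set_mset (ends G e) \<subseteq> S})"
  define iT where "iT = int (card {e \<in> edges G. set_mset (ends G e) \<subseteq> T})"
  define st where "st = int (card (edges_between G S T))"
  define D where "D = int (card T) - int (card S)"
  define m where "m = 2 * int r + 1 - 3 * int k"
  have degA: "(\<Sum>v\<in>A. vertex_degree G v) = (2 * r + 1) * card A" if "A \<subseteq> verts G" for A
    using reg that unfolding d_regular_def by (simp add: subset_iff mult.commute)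
  have sub: "S \<subseteq> verts G" "T \<subseteq> verts G" using cover by auto
  have eT: "(2 * int r + 1) * int (card T) = 2 * iT + st + X"
    using arg_cong[OF degree_sum[OF mg fin(5)], of int] card_boundary_split[of T S] degA[OF sub(2)]
    unfolding iT_def st_def X_def by (simp add: algebra_simps)
  have eS: "(2 * int r + 1) * int (card S) = 2 * iS + st + Y"
    using arg_cong[OF degree_sum[OF mg fin(4)], of int] card_boundary_split[of S T] degA[OF sub(1)]
    unfolding iS_def st_def Y_def by (simp add: algebra_simps)
  have cardO: "int (card {Q \<in> comps. odd (2 * k * card Q + to_T Q)}) = O'"
    unfolding O'_def ob_def using finite_comps by (simp add: Int_def)
  have cardA: "int (card {Q \<in> comps. to_T Q = 1 \<and> to_S Q = 0}) = A"
    unfolding A_def pend_def using finite_comps by (simp add: Int_def)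
  have viol': "2 * int k * int (card S) + (2 * int r + 1) * int (card T) + 1
      \<le> 2 * int k * int (card T) + st + O'"
  proof -
    have "2 * k * card S + (2 * r + 1) * card T + 1 \<le>
      2 * k * card T + card (edges_between G S T) + card {Q \<in> comps. odd (2 * k * card Q + to_T Q)}"
      using viol degA[OF sub(2)] by simp
    hence "int (2 * k * card S + (2 * r + 1) * card T + 1) \<le>
      int (2 * k * card T + card (edges_between G S T) + card {Q \<in> comps. odd (2 * k * card Q + to_T Q)})"
      by (simp only: of_nat_le_iff)
    thus ?thesis unfolding cardO[symmetric] st_def by (simp add: algebra_simps)
  qed
  have "2 dvd (\<Sum>Q\<in>comps. int (to_T Q) - ob Q)" by (rule dvd_sum) (simp add: ob_def)
  then obtain h where h: "X - O' = 2 * h" unfolding X_def O'_def sum_subtractf by (elim dvdE)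
  have "0 \<le> (\<Sum>Q\<in>comps. int (to_T Q) - ob Q)"
    by (rule sum_nonneg) (auto simp: ob_def of_bool_def elim: oddE)
  hence h0: "0 \<le> h" using h unfolding X_def O'_def sum_subtractf by simp
  \<comment> \<open>Half of the first bound. The parity of \<open>X - O'\<close> sharpens a strict inequality by one.\<close>
  have kD: "iT + h + 1 \<le> int k * D" using viol' eT h unfolding D_def by (simp add: algebra_simps)
  have iS0: "0 \<le> iS" and iT0: "0 \<le> iT" unfolding iS_def iT_def by simp_all
  have "0 < int k * D" using kD h0 iT0 by linarith
  hence D1: "1 \<le> D" using k(1) by (simp add: zero_less_mult_iff)
  have m0: "0 \<le> m" using k(2) unfolding m_def by linarith
  have "0 \<le> m * (D - 1)" using m0 D1 by simp
  hence mD: "m \<le> m * D" by (simp add: algebra_simps)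
  have rD: "m * D + 3 * (int k * D) = 2 * iT + X - 2 * iS - Y"
    using eT eS unfolding D_def m_def by (simp add: algebra_simps)
  have Wterm: "0 \<le> 2 * pend Q - 3 * ob Q + int (to_T Q) + 2 * int (to_S Q)" for Q
  proof -
    have "3 \<le> to_T Q" if "odd (to_T Q)" "to_T Q \<noteq> 1" using that by presburger
    thus ?thesis unfolding pend_def ob_def
      by (cases "to_T Q = 1"; cases "to_S Q = 0") (auto simp: of_bool_def)
  qed
  have W0: "0 \<le> W" unfolding W_def using Wterm by (intro sum_nonneg)
  have W: "W = 2 * A - 3 * O' + X + 2 * Y"
    unfolding W_def A_def O'_def X_def Y_def
    by (simp add: sum.distrib sum_subtractf sum_distrib_left)
  have Am: "A \<le> m + 3"
    using pendant_components_cut_edges(1) cardA cuts k(2) unfolding m_def by simp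
  \<comment> \<open>\<open>W\<close> is the total slack of the estimates for the single components; \<open>m * (D - 1)\<close> is the slack
    from \<open>D \<ge> 1\<close>.\<close>
  have tight: "iT = 0" "iS = 0" "W = 0" "A = m + 3" "int k * D = h + 1" "m * D = m"
    using kD mD rD W W0 Am h h0 iT0 iS0 by linarith+
  show "card S < card T" using D1 unfolding D_def by simp
  show "independent_set G S" "independent_set G T"
    using tight(1,2) fin(2) unfolding iS_def iT_def independent_set_def by auto
  have types: "(to_T Q, to_S Q) \<in> {(0, 0), (1, 0), (1, 1), (3, 0)}" if Q: "Q \<in> comps" for Q
  proof -
    have "2 * pend Q - 3 * ob Q + int (to_T Q) + 2 * int (to_S Q) = 0"
      using tight(3) Q Wterm finite_comps unfolding W_def by (simp add: sum_nonneg_eq_0_iff)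
    moreover have "to_T Q \<le> 3 \<and> to_S Q \<le> 1"
      using calculation unfolding pend_def ob_def by (auto simp: of_bool_def split: if_splits)
    ultimately show ?thesis unfolding pend_def ob_def
      by (auto simp: of_bool_def split: if_splits elim: oddE)
  qed
  show "(to_T Q, to_S Q) \<in> {(0, 0), (1, 0), (1, 1), (3, 0)}" if "Q \<in> comps" for Q
    using types[OF that] .
  show "card {Q \<in> comps. to_T Q = 1 \<and> to_S Q = 0} = card (cut_edges G)"
    using tight(4) cardA cuts k(2) unfolding m_def by simp
  have "2 * h = (\<Sum>Q\<in>comps. int (to_T Q) - ob Q)"
    using h unfolding X_def O'_def sum_subtractf by simp
  also have "\<dots> = (\<Sum>Q\<in>comps. 2 * of_bool (to_T Q = 3))"
    using types by (intro sum.cong) (fastforce simp: ob_def)+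
  also have "\<dots> = 2 * int (card {Q \<in> comps. to_T Q = 3})"
    using finite_comps by (simp add: Int_def flip: sum_distrib_left)
  finally have "int k * D = int (card {Q \<in> comps. to_T Q = 3}) + 1" using tight(5) by simp
  moreover have Dn: "D = int (card T - card S)" using D1 unfolding D_def by simp
  ultimately have "int (k * (card T - card S)) = int (card {Q \<in> comps. to_T Q = 3} + 1)"
    by (simp only: of_nat_mult of_nat_add of_nat_1)
  hence "k * (card T - card S) = card {Q \<in> comps. to_T Q = 3} + 1" by (simp only: of_nat_eq_iff)
  thus "card {Q \<in> comps. to_T Q = 3} = k * (card T - card S) - 1" by simp
  show "card T - card S = 1" if "3 * k < 2 * r + 1"
  proof -
    have "m * (D - 1) = 0" using tight(6) by (simp add: algebra_simps)
    moreover have "m \<noteq> 0" using that unfolding m_def by linarith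
    ultimately show ?thesis using Dn by simp
  qed
qed

text \<open>
  Components at a cut-edge, blisters, and components with three edges to \<open>T\<close> all send an odd number
  of edges to \<open>T\<close>. They are numerous enough to violate the inequality that a \<open>2k\<close>-factor would
  force: their numbers are \<open>2 r + 4 - 3 k\<close>, at least the number of edges from \<open>S\<close> to \<open>R\<close>, and
  \<open>k D - 1\<close>.
\<close>
lemma no_factor_if_tight:
  assumes reg: "d_regular (2 * r + 1) G" and k: "k > 0" "3 * k \<le> 2 * r + 1"
    and cuts: "card (cut_edges G) = 2 * r + 4 - 3 * k"
    and indS: "independent_set G S" and ST: "card S < card T"
    and b1: "\<forall>e\<in>cut_edges G. \<exists>C\<in>comps. e \<in> edges_between G T C"
    and b3: "\<forall>e\<in>cut_edges G. \<forall>C\<in>comps. e \<in> edges_between G T C \<longrightarrow> edges_between G (S \<union> T) C = {e}"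
    and c: "\<forall>e\<in>edges G. \<forall>s\<in>S. s \<in># ends G e \<longrightarrow>
      (\<exists>t\<in>T. ends G e = {#s, t#}) \<or>
      (\<exists>C\<in>comps. blister (2 * r + 1) G S T C \<and> (\<exists>q\<in>C. ends G e = {#s, q#}))"
    and d: "card {C \<in> comps. to_T C = 3} = k * (card T - card S) - 1"
    and f: "3 * k < 2 * r + 1 \<Longrightarrow> card T - card S = 1"
  shows "\<not> has_factor (2 * k) G"
proof
  assume fac: "has_factor (2 * k) G"
  have RV: "verts G - S - T = R" using cover disj by blast
  have sub: "S \<subseteq> verts G" "T \<subseteq> verts G" using cover by auto
  have degA: "(\<Sum>v\<in>A. vertex_degree G v) = (2 * r + 1) * card A" if "A \<subseteq> verts G" for A
    using reg that unfolding d_regular_def by (simp add: subset_iff mult.commute)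
  let ?odd = "{Q \<in> comps. odd (2 * k * card Q + to_T Q)}"
  define P where "P = {Q \<in> comps. to_T Q = 1 \<and> to_S Q = 0}"
  define B where "B = {Q \<in> comps. to_S Q = 1 \<and> to_T Q = 1}"
  define C3 where "C3 = {Q \<in> comps. to_T Q = 3}"
  have finPBC: "finite P" "finite B" "finite C3" unfolding P_def B_def C3_def using finite_comps by auto
  have ineq: "2 * k * card T + card (edges_between G S T) + card ?odd
      \<le> 2 * k * card S + (2 * r + 1) * card T"
    using regular_factor_inequality[OF mg fac sub disj(3)] degA[OF sub(2)] unfolding RV by simp
  have "edges_between G A Q \<subseteq> edges_between G (S \<union> T) Q" if "A \<subseteq> S \<union> T" for A Q
    using that unfolding edges_between_def by blast
  note sub_ST = this[of S] this[of T]
  have disj_ST: "edges_between G S Q \<inter> edges_between G T Q = {}" if Q: "Q \<in> comps" for Q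
  proof (rule ccontr)
    assume "edges_between G S Q \<inter> edges_between G T Q \<noteq> {}"
    then obtain e where e: "e \<in> edges_between G S Q" "e \<in> edges_between G T Q" by blast
    then obtain s q where sq: "ends G e = {#s, q#}" "s \<in> S" "q \<in> Q" unfolding edges_between_def by blast
    have "q \<in> R" using sq comp_subset[OF Q] by blast
    thus False using e(2) edges_between_iff[OF sq(1), of T Q] sq disj by blast
  qed
  have "card (cut_edges G) \<le> card P"
  proof -
    define \<psi> where "\<psi> e = (SOME C. C \<in> comps \<and> e \<in> edges_between G T C)" for e
    have \<psi>: "\<psi> e \<in> comps \<and> e \<in> edges_between G T (\<psi> e)" if "e \<in> cut_edges G" for e
      unfolding \<psi>_def by (rule someI_ex) (use b1 that in blast)
    have single: "edges_between G (S \<union> T) (\<psi> e) = {e}" if "e \<in> cut_edges G" for e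
      using b3 that \<psi>[OF that] by blast
    have "\<psi> e \<in> P" if e: "e \<in> cut_edges G" for e
    proof -
      have "edges_between G T (\<psi> e) = {e}" using single[OF e] \<psi>[OF e] sub_ST(2)[of "\<psi> e"] by blast
      moreover from this have "edges_between G S (\<psi> e) = {}"
        using single[OF e] \<psi>[OF e] sub_ST(1)[of "\<psi> e"] disj_ST[of "\<psi> e"] by blast
      ultimately show ?thesis using \<psi>[OF e] unfolding P_def by simp
    qed
    moreover have "inj_on \<psi> (cut_edges G)"
      by (rule inj_onI) (metis single singleton_inject)
    ultimately show ?thesis using finPBC(1) by (intro card_inj_on_le[of \<psi>]) auto
  qed
  have to_S_le: "to_S Q \<le> of_bool (Q \<in> B)" if Q: "Q \<in> comps" for Q
  proof (cases "edges_between G S Q = {}")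
    case False
    then obtain e s q where e: "e \<in> edges G" "s \<in> S" "q \<in> Q" "ends G e = {#s, q#}"
      unfolding edges_between_def by blast
    have q: "q \<in> R" "q \<notin> T" "q \<notin> S" using e(3) comp_subset[OF Q] disj by blast+
    have "s \<in># ends G e" using e(4) by simp
    with c e(1,2) have "(\<exists>t\<in>T. ends G e = {#s, t#}) \<or>
      (\<exists>C\<in>comps. blister (2 * r + 1) G S T C \<and> (\<exists>q\<in>C. ends G e = {#s, q#}))" by blast
    moreover have "ends G e \<noteq> {#s, t#}" if "t \<in> T" for t using e(4) q that by auto
    ultimately obtain C q' where C: "C \<in> comps" "blister (2 * r + 1) G S T C" "q' \<in> C" "ends G e = {#s, q'#}"
      by blast
    have "q' = q" using C(4) e(4) by simp
    hence "q \<in> C" using C(3) by simp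
    from graph_components_disjoint[OF Q C(1) e(3) this] have bl: "blister (2 * r + 1) G S T Q" using C(2) by simp
    then obtain f g s' t p q'' where fg: "s' \<in> S" "t \<in> T" "p \<in> Q" "q'' \<in> Q" "f \<noteq> g"
      "edges_between G Q (S \<union> T) = {f, g}" "ends G f = {#s', p#}" "ends G g = {#t, q''#}"
      unfolding blister_def by blast
    have all: "edges_between G S Q \<union> edges_between G T Q = {f, g}"
      using comp_boundary(2)[OF Q] fg(6) edges_between_commute[of G Q "S \<union> T"] by simp
    have "f \<in> edges G" "g \<in> edges G" using fg(6) unfolding edges_between_def by blast+
    hence "f \<in> edges_between G S Q" "g \<in> edges_between G T Q"
      using fg unfolding edges_between_def by blast+
    hence "edges_between G S Q = {f}" "edges_between G T Q = {g}" using all disj_ST[OF Q] by blast+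
    thus ?thesis using Q unfolding B_def by simp
  qed simp
  have "(\<Sum>Q\<in>comps. to_S Q) \<le> (\<Sum>Q\<in>comps. of_bool (Q \<in> B))" using to_S_le by (rule sum_mono)
  also have "\<dots> = card B"
    using finite_comps unfolding B_def by (simp add: Int_def)
  finally have sumB: "(\<Sum>Q\<in>comps. to_S Q) \<le> card B" .
  have inS: "{e \<in> edges G. set_mset (ends G e) \<subseteq> S} = {}" using indS unfolding independent_set_def by blast
  hence eS: "(2 * r + 1) * card S = card (edges_between G S T) + (\<Sum>Q\<in>comps. to_S Q)"
    using degree_sum[OF mg fin(4), unfolded inS] card_boundary_split[of S T] degA[OF sub(1)] by simp
  have "P \<inter> B = {}" "(P \<union> B) \<inter> C3 = {}" unfolding P_def B_def C3_def by auto
  hence "card (P \<union> B \<union> C3) = card P + card B + card C3"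
    using finPBC by (simp add: card_Un_disjoint)
  moreover have "P \<union> B \<union> C3 \<subseteq> ?odd" unfolding P_def B_def C3_def by auto
  hence "card (P \<union> B \<union> C3) \<le> card ?odd" using finite_comps by (intro card_mono) auto
  ultimately have q: "card (cut_edges G) + (\<Sum>Q\<in>comps. to_S Q) + card C3 \<le> card ?odd"
    using \<open>card (cut_edges G) \<le> card P\<close> sumB by linarith
  obtain D where D: "card T = card S + D" "D > 0" using ST less_imp_add_positive by metis
  have "card C3 = k * D - 1" using d D unfolding C3_def by simp
  moreover have "k * D \<ge> 1" using k(1) D(2) by simp
  ultimately have c3: "card C3 + 1 = k * D" by simp
  have "card (cut_edges G) + 3 * k = 2 * r + 4" using cuts k(2) by simp
  hence "3 * (k * D) + (2 * r + 4) \<le> (2 * r + 1) * D + 3 * k + 1"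
    using ineq q eS c3 unfolding D(1) by (simp add: algebra_simps)
  moreover have "(2 * r + 1) * D + 3 * k = 3 * (k * D) + (2 * r + 1)"
  proof (cases "3 * k < 2 * r + 1")
    case True
    hence "D = 1" using f D(1) by simp
    thus ?thesis by simp
  next
    case False
    hence "2 * r + 1 = 3 * k" using k(2) by simp
    thus ?thesis by (metis add.commute mult.assoc)
  qed
  ultimately show False by linarith
qed

end

section \<open>Odd-degree regular graphs with a critical number of cut-edges\<close>

theorem theorem1p3:
  fixes G :: "('v, 'e) mgraph" and r k :: nat
  assumes "multigraph G"
    and "r > 0" and "k > 0" and "real k \<le> (2 * real r + 1) / 3"
    and "d_regular (2 * r + 1) G"
    and "card (cut_edges G) = 2 * r + 1 - 3 * (k - 1)"
  shows "\<not> has_factor (2 * k) G \<longleftrightarrow>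
    (\<exists>R S T.
      R \<union> S \<union> T = verts G \<and> R \<inter> S = {} \<and> R \<inter> T = {} \<and> S \<inter> T = {} \<and>
      (independent_set G S \<and> independent_set G T \<and> card T > card S) \<and>
      ((\<forall>e\<in>cut_edges G. \<exists>C\<in>graph_components (induced_subgraph G R). e \<in> edges_between G T C) \<and>
       (\<forall>e\<in>cut_edges G. \<forall>e'\<in>cut_edges G. \<forall>C\<in>graph_components (induced_subgraph G R).
          e \<in> edges_between G T C \<and> e' \<in> edges_between G T C \<longrightarrow> e = e') \<and>
       (\<forall>e\<in>cut_edges G. \<forall>C\<in>graph_components (induced_subgraph G R).
          e \<in> edges_between G T C \<longrightarrow> edges_between G (S \<union> T) C = {e})) \<and>
      (\<forall>e\<in>edges G. \<forall>s\<in>S. s \<in># ends G e \<longrightarrow>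
         (\<exists>t\<in>T. ends G e = {#s, t#}) \<or>
         (\<exists>C\<in>graph_components (induced_subgraph G R). blister (2 * r + 1) G S T C \<and>
            (\<exists>q\<in>C. ends G e = {#s, q#}))) \<and>
      card {C \<in> graph_components (induced_subgraph G R). card (edges_between G T C) = 3}
        = k * (card T - card S) - 1 \<and>
      (\<forall>C\<in>graph_components (induced_subgraph G R).
         (\<nexists>e. e \<in> cut_edges G \<and> e \<in> edges_between G T C) \<and>
         \<not> blister (2 * r + 1) G S T C \<and>
         card (edges_between G T C) \<noteq> 3 \<longrightarrow>
         d_regular (2 * r + 1) (induced_subgraph G C) \<and> cut_edges (induced_subgraph G C) = {}) \<and>
      (real k < (2 * real r + 1) / 3 \<longrightarrow> card T - card S = 1))" (is "_ \<longleftrightarrow> ?structure")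
proof -
  note G = assms(1) and kpos = assms(3) and reg = assms(5)
  have "real (3 * k) \<le> real (2 * r + 1)" using assms(4) by (simp add: field_simps)
  hence k3: "3 * k \<le> 2 * r + 1" by (simp only: of_nat_le_iff)
  have cuts: "card (cut_edges G) = 2 * r + 4 - 3 * k" using assms(6) kpos k3 by simp
  have "real k < (2 * real r + 1) / 3 \<longleftrightarrow> real (3 * k) < real (2 * r + 1)"
    by (auto simp: field_simps)
  hence k3_less: "real k < (2 * real r + 1) / 3 \<longleftrightarrow> 3 * k < 2 * r + 1" by (simp only: of_nat_less_iff)
  show ?thesis
  proof
    assume "\<not> has_factor (2 * k) G"
    then obtain S T where ST: "S \<subseteq> verts G" "T \<subseteq> verts G" "S \<inter> T = {}"
      and viol: "2 * k * card S + (\<Sum>v\<in>T. vertex_degree G v) <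
        2 * k * card T + card (edges_between G S T) +
        card {Q \<in> graph_components (induced_subgraph G (verts G - S - T)).
          odd (2 * k * card Q + card (edges_between G T Q))}"
      unfolding regular_factor_theorem[OF G] by (meson not_less)
    define R where "R = verts G - S - T"
    interpret factor_partition G R S T
      by unfold_locales (use G ST in \<open>auto simp: R_def\<close>)
    note tight = tight_structure[OF reg kpos k3 cuts viol[folded R_def]]
    have cut_comp: "\<exists>C\<in>comps. to_T C = 1 \<and> to_S C = 0 \<and> e \<in> edges_between G T C" if "e \<in> cut_edges G" for e
      using pendant_components_cut_edges(2)[OF tight(5) that] by blast
    have cut_TR: "cut_edges G \<subseteq> edges_between G T R"
    proof
      fix e assume "e \<in> cut_edges G"
      then obtain C where "C \<in> comps" "e \<in> edges_between G T C" using cut_comp by blast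
      thus "e \<in> edges_between G T R" using comp_subset unfolding edges_between_def by blast
    qed
    have TR: "T \<inter> R = {}" using disj by blast
    have b3: "edges_between G (S \<union> T) C = {e}"
      if e: "e \<in> cut_edges G" and C: "C \<in> comps" "e \<in> edges_between G T C" for e C
    proof -
      obtain C' where C': "C' \<in> comps" "to_T C' = 1" "to_S C' = 0" "e \<in> edges_between G T C'"
        using cut_comp[OF e] by blast
      have "C = C'" by (rule comp_unique[OF C(1) C'(1) TR TR C(2) C'(4)])
      moreover obtain e' where "edges_between G T C' = {e'}" "edges_between G (S \<union> T) C' = {e'}"
        using pendant_component[OF C'(1,2,3)] by blast
      ultimately show ?thesis using C(2) by simp
    qed
    have c: "(\<exists>t\<in>T. ends G e = {#s, t#}) \<or>
         (\<exists>C\<in>comps. blister (2 * r + 1) G S T C \<and> (\<exists>q\<in>C. ends G e = {#s, q#}))"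
      if e: "e \<in> edges G" "s \<in> S" "s \<in># ends G e" for e s
    proof -
      obtain b where b: "ends G e = {#s, b#}"
      proof -
        obtain a b where ab: "ends G e = {#a, b#}" using multigraph_endsD[OF G e(1)] .
        hence "s = a \<or> s = b" using e(3) by auto
        thus ?thesis using that ab by (auto simp: add_mset_commute)
      qed
      have "b \<in> verts G" using G e(1) b unfolding multigraph_def by auto
      moreover have "b \<notin> S" using tight(2) e b unfolding independent_set_def by auto
      ultimately have "b \<in> T \<or> b \<in> \<Union>comps" using cover comps_Union by blast
      thus ?thesis
      proof
        assume "b \<in> T" thus ?thesis using b by blast
      next
        assume "b \<in> \<Union>comps"
        then obtain C where C: "C \<in> comps" "b \<in> C" by blast
        have "e \<in> edges_between G S C" using e b C unfolding edges_between_def by blast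
        hence "to_S C \<noteq> 0" using finite_edges_between[OF G] by auto
        hence "to_T C = 1" "to_S C = 1" using tight(4)[OF C(1)] by auto
        from blister_if_single_edges[OF reg cut_TR C(1) this] show ?thesis using C b by blast
      qed
    qed
    have rest: "d_regular (2 * r + 1) (induced_subgraph G C) \<and> cut_edges (induced_subgraph G C) = {}"
      if C: "C \<in> comps" and nocut: "\<nexists>e. e \<in> cut_edges G \<and> e \<in> edges_between G T C"
        and nobl: "\<not> blister (2 * r + 1) G S T C" and no3: "to_T C \<noteq> 3" for C
    proof -
      have "\<not> (to_T C = 1 \<and> to_S C = 0)" using pendant_component[OF C] nocut by blast
      moreover have "\<not> (to_T C = 1 \<and> to_S C = 1)" using blister_if_single_edges[OF reg cut_TR C] nobl by blast
      ultimately have "to_T C = 0" "to_S C = 0" using tight(4)[OF C] no3 by auto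
      from isolated_component_no_cut_edges[OF reg cut_TR C this] show ?thesis .
    qed
    show ?structure
    proof (rule exI[of _ R], rule exI[of _ S], rule exI[of _ T], intro conjI)
      show "\<forall>e\<in>cut_edges G. \<exists>C\<in>comps. e \<in> edges_between G T C" using cut_comp by blast
      show "\<forall>e\<in>cut_edges G. \<forall>e'\<in>cut_edges G. \<forall>C\<in>comps.
          e \<in> edges_between G T C \<and> e' \<in> edges_between G T C \<longrightarrow> e = e'"
        using b3 by (metis singleton_inject)
      show "\<forall>e\<in>cut_edges G. \<forall>C\<in>comps. e \<in> edges_between G T C \<longrightarrow> edges_between G (S \<union> T) C = {e}"
        using b3 by blast
      show "\<forall>e\<in>edges G. \<forall>s\<in>S. s \<in># ends G e \<longrightarrow> (\<exists>t\<in>T. ends G e = {#s, t#}) \<or>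
         (\<exists>C\<in>comps. blister (2 * r + 1) G S T C \<and> (\<exists>q\<in>C. ends G e = {#s, q#}))"
        using c by blast
      show "\<forall>C\<in>comps. (\<nexists>e. e \<in> cut_edges G \<and> e \<in> edges_between G T C) \<and>
         \<not> blister (2 * r + 1) G S T C \<and> to_T C \<noteq> 3 \<longrightarrow>
         d_regular (2 * r + 1) (induced_subgraph G C) \<and> cut_edges (induced_subgraph G C) = {}"
        using rest by blast
      show "real k < (2 * real r + 1) / 3 \<longrightarrow> card T - card S = 1" using tight(7) k3_less by blast
    qed (use cover disj tight in simp_all)
  next
    assume ?structure
    then obtain R S T where part: "R \<union> S \<union> T = verts G" "R \<inter> S = {}" "R \<inter> T = {}" "S \<inter> T = {}"
      and st: "independent_set G S" "card S < card T"
      and b: "\<forall>e\<in>cut_edges G. \<exists>C\<in>graph_components (induced_subgraph G R). e \<in> edges_between G T C"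
        "\<forall>e\<in>cut_edges G. \<forall>C\<in>graph_components (induced_subgraph G R).
          e \<in> edges_between G T C \<longrightarrow> edges_between G (S \<union> T) C = {e}"
      and c: "\<forall>e\<in>edges G. \<forall>s\<in>S. s \<in># ends G e \<longrightarrow> (\<exists>t\<in>T. ends G e = {#s, t#}) \<or>
         (\<exists>C\<in>graph_components (induced_subgraph G R). blister (2 * r + 1) G S T C \<and>
            (\<exists>q\<in>C. ends G e = {#s, q#}))"
      and d: "card {C \<in> graph_components (induced_subgraph G R). card (edges_between G T C) = 3}
        = k * (card T - card S) - 1"
      and f: "3 * k < 2 * r + 1 \<longrightarrow> card T - card S = 1"
      unfolding k3_less by (elim exE conjE) rule
    interpret factor_partition G R S T by unfold_locales (use G part in auto)
    show "\<not> has_factor (2 * k) G"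
      by (rule no_factor_if_tight[OF reg kpos k3 cuts st b c d]) (use f in blast)
  qed
qed

end
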